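(* The quotient space of variational symmetries (or, equivalently, of conservation-law characteristics) of the equation $w_{\xi\eta}=0$ is naturally isomorphic to the subspace of its variational symmetries of the form \[ \lambda=\sum_{l\ge1}(-\mathcal D_\eta)^{l-1}\partial_{w_{0l}}F+\sum_{k\ge1}(-\mathcal D_\xi)^{k-1}\partial_{w_{k0}}G , \] where $F=F(\eta,w_{01},\dots,w_{0r_1})$ is an arbitrary smooth function of $\eta$ and a finite number of $w_{0l}$, $l\ge1$, $G=G(\xi,w_{10},\dots,w_{r_20})$ is an arbitrary smooth function of $\xi$ and a finite number of $w_{k0}$, $k\ge1$ ($r_1,r_2\in\mathbb N_0$), and \[ \mathcal D_\xi:=\partial_\xi+\sum_{k\ge1}w_{k+1,0}\partial_{w_{k0}},\qquad \mathcal D_\eta:=\partial_\eta+\sum_{l\ge1}w_{0,l+1}\partial_{w_{0l}} . \]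
   Context: The equation is $\mathcal W$: $w_{\xi\eta}=0$ for an unknown function $w=w(\xi,\eta)$. Write $w_{kl}:=\partial^{k+l}w/\partial\xi^k\partial\eta^l$, $k,l\in\mathbb N_0=\{0,1,2,\dots\}$ (so $w_{00}=w$, $w_{11}=w_{\xi\eta}$), regarded as jet variables. A differential function of $w$ is a smooth function of $\xi$, $\eta$ and finitely many $w_{kl}$. The total derivative operators are $\mathrm D_\xi=\partial_\xi+\sum_{k,l\ge0}w_{k+1,l}\partial_{w_{kl}}$ and $\mathrm D_\eta=\partial_\eta+\sum_{k,l\ge0}w_{k,l+1}\partial_{w_{kl}}$. A differential function vanishes on solutions of $\mathcal W$ if it vanishes whenever $w_{kl}=0$ for all $k,l\ge1$. A conservation-law characteristic of $\mathcal W$ is a differential function $\lambda$ such that $\lambda w_{\xi\eta}=\mathrm D_\xi P+\mathrm D_\eta Q$ identically for some differential functions $P,Q$. By Noether's theorem, these are the same as the variational symmetries $\lambda\partial_w$ (in evolution form, identified with $\lambda$) of the functional with Lagrangian $-\frac12w_\xi w_\eta$, whose Euler–Lagrange equation is $\mathcal W$; "variational symmetries of $\mathcal W$" means variational symmetries of this functional. Two characteristics (variational symmetries) are equivalent if their difference vanishes on solutions of $\mathcal W$, and the quotient space is the quotient with respect to this equivalence. "Naturally isomorphic" means that the isomorphism maps each $\lambda$ of the indicated form to its equivalence class. All considerations are local: differential functions may be restricted to a sufficiently small neighbourhood of a point of the solution set of $\mathcal W$ in the jet space. *)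

theory Defs
  imports "HOL-Analysis.Analysis" "HOL-Library.Function_Algebras"
begin

section \<open>Jet space and differential functions\<close>

text \<open>
  The jet variables are \<open>\<xi>\<close>, \<open>\<eta>\<close> and \<open>w\<^sub>k\<^sub>l\<close> (written \<open>W k l\<close>, so that \<open>W 0 0\<close> is \<open>w\<close> itself).
  A point of the infinite jet space assigns a real number to each of them.  The topology of
  \<^typ>\<open>'a \<Rightarrow> real\<close> is the product topology: a neighbourhood of a point restricts only
  finitely many jet variables.

  Locality is expressed by germs.  A differential function near a point \<open>p\<close> is represented by
  a total function on the jet space, of which only the values near \<open>p\<close> matter; identities
  hold \<open>eventually\<close> with respect to \<open>nhds p\<close>.
\<close>

datatype coord = Xi | Eta | W nat nat

type_synonym jet = "coord \<Rightarrow> real"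

definition pd :: "coord \<Rightarrow> (jet \<Rightarrow> real) \<Rightarrow> jet \<Rightarrow> real"
  where "pd c f x = deriv (\<lambda>t. f (x(c := t))) (x c)"

text \<open>
  Smoothness: all iterated partial derivatives exist and are continuous.  This is the usual
  notion for functions that depend on finitely many variables, and it is used only for these.
\<close>

definition jet_smooth_on :: "jet set \<Rightarrow> (jet \<Rightarrow> real) \<Rightarrow> bool"
  where "jet_smooth_on U f \<longleftrightarrow>
    (\<forall>cs. continuous_on U (foldr pd cs f) \<and>
      (\<forall>x\<in>U. \<forall>c. (\<lambda>t. foldr pd cs f (x(c := t))) differentiable (at (x c))))"

definition depends_only_on :: "jet set \<Rightarrow> coord set \<Rightarrow> (jet \<Rightarrow> real) \<Rightarrow> bool"
  where "depends_only_on U S f \<longleftrightarrow>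
    (\<forall>x\<in>U. \<forall>y\<in>U. (\<forall>c\<in>S. x c = y c) \<longrightarrow> f x = f y)"

definition smooth_functions_of :: "jet \<Rightarrow> coord set \<Rightarrow> (jet \<Rightarrow> real) set"
  where "smooth_functions_of p S =
    {f. \<exists>U. open U \<and> p \<in> U \<and> jet_smooth_on U f \<and> depends_only_on U S f}"

definition diff_functions :: "jet \<Rightarrow> (jet \<Rightarrow> real) set"
  where "diff_functions p = (\<Union>S\<in>{S. finite S}. smooth_functions_of p S)"

text \<open>
  Near \<open>p\<close> the sums below range over finite sets whenever \<open>f\<close> is a differential function
  near \<open>p\<close>, since only finitely many of its partial derivatives are nonzero.
\<close>

definition D_xi :: "(jet \<Rightarrow> real) \<Rightarrow> jet \<Rightarrow> real"
  where "D_xi f x = pd Xi f x +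
    (\<Sum>(k, l) | pd (W k l) f x \<noteq> 0. x (W (Suc k) l) * pd (W k l) f x)"

definition D_eta :: "(jet \<Rightarrow> real) \<Rightarrow> jet \<Rightarrow> real"
  where "D_eta f x = pd Eta f x +
    (\<Sum>(k, l) | pd (W k l) f x \<noteq> 0. x (W k (Suc l)) * pd (W k l) f x)"

definition total_divergence :: "jet \<Rightarrow> (jet \<Rightarrow> real) \<Rightarrow> bool"
  where "total_divergence p f \<longleftrightarrow>
    (\<exists>P\<in>diff_functions p. \<exists>Q\<in>diff_functions p.
      \<forall>\<^sub>F x in nhds p. f x = D_xi P x + D_eta Q x)"

section \<open>The equation \<open>w\<^sub>\<xi>\<^sub>\<eta> = 0\<close>\<close>

definition solution_set :: "jet set"
  where "solution_set = {x. \<forall>k\<ge>1. \<forall>l\<ge>1. x (W k l) = 0}"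

definition vanishing_on_solutions :: "jet \<Rightarrow> (jet \<Rightarrow> real) set"
  where "vanishing_on_solutions p =
    {f. \<forall>\<^sub>F x in nhds p. x \<in> solution_set \<longrightarrow> f x = 0}"

definition vanishing_germ :: "jet \<Rightarrow> (jet \<Rightarrow> real) set"
  where "vanishing_germ p = {f. \<forall>\<^sub>F x in nhds p. f x = 0}"

definition cl_characteristics :: "jet \<Rightarrow> (jet \<Rightarrow> real) set"
  where "cl_characteristics p =
    {\<mu> \<in> diff_functions p. total_divergence p (\<lambda>x. \<mu> x * x (W 1 1))}"

definition lagrangian :: "jet \<Rightarrow> real"
  where "lagrangian x = - (1 / 2) * x (W 1 0) * x (W 0 1)"

text \<open>The infinite prolongation of the evolutionary vector field \<open>\<mu> \<partial>\<^sub>w\<close>, applied to \<open>f\<close>:\<close>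

definition prolongation :: "(jet \<Rightarrow> real) \<Rightarrow> (jet \<Rightarrow> real) \<Rightarrow> jet \<Rightarrow> real"
  where "prolongation \<mu> f x =
    (\<Sum>(k, l) | pd (W k l) f x \<noteq> 0. (D_xi ^^ k) ((D_eta ^^ l) \<mu>) x * pd (W k l) f x)"

text \<open>As usual, the functional has to be preserved only up to a total divergence in the Lagrangian.\<close>

definition variational_symmetries :: "jet \<Rightarrow> (jet \<Rightarrow> real) set"
  where "variational_symmetries p =
    {\<mu> \<in> diff_functions p. total_divergence p (prolongation \<mu> lagrangian)}"

section \<open>The distinguished variational symmetries\<close>

definition RD_xi :: "(jet \<Rightarrow> real) \<Rightarrow> jet \<Rightarrow> real"
  where "RD_xi f x = pd Xi f x +
    (\<Sum>k | 1 \<le> k \<and> pd (W k 0) f x \<noteq> 0. x (W (Suc k) 0) * pd (W k 0) f x)"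

definition RD_eta :: "(jet \<Rightarrow> real) \<Rightarrow> jet \<Rightarrow> real"
  where "RD_eta f x = pd Eta f x +
    (\<Sum>l | 1 \<le> l \<and> pd (W 0 l) f x \<noteq> 0. x (W 0 (Suc l)) * pd (W 0 l) f x)"

text \<open>
  The sums over \<open>l \<ge> 1\<close> and \<open>k \<ge> 1\<close> stop at \<open>r\<^sub>1\<close> and \<open>r\<^sub>2\<close>, because \<open>F\<close> does not depend
  on \<open>w\<^sub>0\<^sub>l\<close> for \<open>l > r\<^sub>1\<close>, nor \<open>G\<close> on \<open>w\<^sub>k\<^sub>0\<close> for \<open>k > r\<^sub>2\<close>.
\<close>

definition special_form ::
    "nat \<Rightarrow> nat \<Rightarrow> (jet \<Rightarrow> real) \<Rightarrow> (jet \<Rightarrow> real) \<Rightarrow> jet \<Rightarrow> real"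
  where "special_form r\<^sub>1 r\<^sub>2 F G x =
    (\<Sum>l = 1..r\<^sub>1. ((\<lambda>f. - RD_eta f) ^^ (l - 1)) (pd (W 0 l) F) x) +
    (\<Sum>k = 1..r\<^sub>2. ((\<lambda>f. - RD_xi f) ^^ (k - 1)) (pd (W k 0) G) x)"

definition special_functions :: "jet \<Rightarrow> (jet \<Rightarrow> real) set"
  where "special_functions p =
    {\<mu>. \<exists>r\<^sub>1 r\<^sub>2.
      \<exists>F\<in>smooth_functions_of p (insert Eta {W 0 l |l. 1 \<le> l \<and> l \<le> r\<^sub>1}).
      \<exists>G\<in>smooth_functions_of p (insert Xi {W k 0 |k. 1 \<le> k \<and> k \<le> r\<^sub>2}).
        \<forall>\<^sub>F x in nhds p. \<mu> x = special_form r\<^sub>1 r\<^sub>2 F G x}"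

section \<open>Quotient spaces\<close>

interpretation jetfun: vector_space "\<lambda>(c::real) (f::jet \<Rightarrow> real) x. c * f x"
  by unfold_locales (auto simp: fun_eq_iff algebra_simps)

text \<open>
  For subspaces \<open>V\<close> and \<open>N\<close>, \<open>V // coset_rel V N\<close> is the quotient of \<open>V\<close> by \<open>V \<inter> N\<close>; its
  vector space operations are defined on representatives.  With \<open>N = vanishing_germ p\<close>
  the quotient is the space of germs at \<open>p\<close> of elements of \<open>V\<close>.
\<close>

definition coset_rel ::
    "(jet \<Rightarrow> real) set \<Rightarrow> (jet \<Rightarrow> real) set \<Rightarrow> ((jet \<Rightarrow> real) \<times> (jet \<Rightarrow> real)) set"
  where "coset_rel V N = {(f, g). f \<in> V \<and> g \<in> V \<and> f - g \<in> N}"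

lemma equiv_coset_rel:
  assumes "jetfun.subspace N"
  shows "equiv V (coset_rel V N)"
proof (rule equivI)
  show "coset_rel V N \<subseteq> V \<times> V" by (auto simp: coset_rel_def)
  show "refl_on V (coset_rel V N)"
    using jetfun.subspace_0[OF assms] by (auto simp: refl_on_def coset_rel_def)
  show "sym (coset_rel V N)"
    using jetfun.subspace_neg[OF assms] by (fastforce simp: sym_def coset_rel_def)
  show "trans (coset_rel V N)"
    using jetfun.subspace_add[OF assms] by (fastforce simp: trans_def coset_rel_def)
qed

definition class_add ::
    "((jet \<Rightarrow> real) \<times> (jet \<Rightarrow> real)) set \<Rightarrow>
      (jet \<Rightarrow> real) set \<Rightarrow> (jet \<Rightarrow> real) set \<Rightarrow> (jet \<Rightarrow> real) set"
  where "class_add r X Y = (\<Union>f\<in>X. \<Union>g\<in>Y. r `` {f + g})"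

definition class_scale ::
    "((jet \<Rightarrow> real) \<times> (jet \<Rightarrow> real)) set \<Rightarrow>
      real \<Rightarrow> (jet \<Rightarrow> real) set \<Rightarrow> (jet \<Rightarrow> real) set"
  where "class_scale r c X = (\<Union>f\<in>X. r `` {\<lambda>x. c * f x})"

definition quotient_iso ::
    "(jet \<Rightarrow> real) set \<Rightarrow> (jet \<Rightarrow> real) set \<Rightarrow>
      (jet \<Rightarrow> real) set \<Rightarrow> (jet \<Rightarrow> real) set \<Rightarrow>
      ((jet \<Rightarrow> real) set \<Rightarrow> (jet \<Rightarrow> real) set) \<Rightarrow> bool"
  where "quotient_iso V N V' N' \<Phi> \<longleftrightarrow>
    (let r = coset_rel V N; r' = coset_rel V' N' in
      bij_betw \<Phi> (V // r) (V' // r') \<and>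
      (\<forall>X\<in>V // r. \<forall>Y\<in>V // r. \<Phi> (class_add r X Y) = class_add r' (\<Phi> X) (\<Phi> Y)) \<and>
      (\<forall>c. \<forall>X\<in>V // r. \<Phi> (class_scale r c X) = class_scale r' c (\<Phi> X)))"

lemma subspace_vanishing_on_solutions: "jetfun.subspace (vanishing_on_solutions p)"
proof -
  have "f + g \<in> vanishing_on_solutions p"
    if "f \<in> vanishing_on_solutions p" "g \<in> vanishing_on_solutions p" for f g
    using that unfolding vanishing_on_solutions_def mem_Collect_eq
    by eventually_elim simp
  moreover have "(\<lambda>x. c * f x) \<in> vanishing_on_solutions p"
    if "f \<in> vanishing_on_solutions p" for f c
    using that unfolding vanishing_on_solutions_def mem_Collect_eq
    by eventually_elim simp
  moreover have "0 \<in> vanishing_on_solutions p"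
    by (simp add: vanishing_on_solutions_def)
  ultimately show ?thesis by (simp add: jetfun.subspace_def)
qed

lemma subspace_vanishing_germ: "jetfun.subspace (vanishing_germ p)"
proof -
  have "f + g \<in> vanishing_germ p"
    if "f \<in> vanishing_germ p" "g \<in> vanishing_germ p" for f g
    using that unfolding vanishing_germ_def mem_Collect_eq
    by eventually_elim simp
  moreover have "(\<lambda>x. c * f x) \<in> vanishing_germ p"
    if "f \<in> vanishing_germ p" for f c
    using that unfolding vanishing_germ_def mem_Collect_eq
    by eventually_elim simp
  moreover have "0 \<in> vanishing_germ p"
    by (simp add: vanishing_germ_def)
  ultimately show ?thesis by (simp add: jetfun.subspace_def)
qed

end

theory Submission
  imports Defs
begin

text \<open>
  Let \<open>\<mu>\<close> be a characteristic, \<open>\<mu> w\<^sub>1\<^sub>1 = D\<^sub>\<xi> P + D\<^sub>\<eta> Q\<close>, and let a hat denote restriction to the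
  solution set, where \<open>w\<^sub>k\<^sub>l = 0\<close> for \<open>k, l \<ge> 1\<close>.  Differentiating the identity with respect to
  \<open>w\<^sub>k\<^sub>l\<close> for \<open>k, l \<ge> 1\<close> and then restricting it gives, with \<open>P\<^sup>k\<^sup>l\<close> and \<open>Q\<^sup>k\<^sup>l\<close> for the restricted
  derivatives,
    \<open>\<delta> \<mu>^ = (D\<^sub>\<xi> P\<^sup>k\<^sup>l + P\<^sup>k\<^sup>-\<^sup>1\<^sup>,\<^sup>l) + (D\<^sub>\<eta> Q\<^sup>k\<^sup>l + Q\<^sup>k\<^sup>,\<^sup>l\<^sup>-\<^sup>1)\<close>,
  where \<open>\<delta>\<close> is \<open>1\<close> if \<open>k = l = 1\<close> and \<open>0\<close> otherwise.  The alternating sum of all these equations with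
  the operators \<open>(-D\<^sub>\<xi>)\<^sup>k\<^sup>-\<^sup>1 (-D\<^sub>\<eta>)\<^sup>l\<^sup>-\<^sup>1\<close> telescopes to \<open>\<mu>^ = E\<^sub>\<eta> P^ + E\<^sub>\<xi> Q^\<close>, where
  \<open>E\<^sub>\<eta>\<close> is the sum of \<open>(-D\<^sub>\<eta>)\<^sup>l\<^sup>-\<^sup>1 \<partial>/\<partial>w\<^sub>0\<^sub>l\<close> over \<open>l \<ge> 1\<close> and \<open>E\<^sub>\<xi>\<close> is its mirror image
  (\<open>characteristic_on_solutions\<close>).  This is already the required shape, except that \<open>P^\<close> and \<open>Q^\<close>
  may depend on all of \<open>\<xi>\<close>, \<open>\<eta>\<close>, \<open>w\<close>, \<open>w\<^sub>k\<^sub>0\<close>, \<open>w\<^sub>0\<^sub>l\<close> and are tied by \<open>D\<^sub>\<xi> P^ + D\<^sub>\<eta> Q^ = 0\<close>.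

  The usual next step would solve this conservation law as \<open>P^ = F + D\<^sub>\<eta> H\<close>, \<open>Q^ = G - D\<^sub>\<xi> H\<close>.
  Integration can be avoided.  Since \<open>E\<^sub>\<eta>\<close> commutes with \<open>D\<^sub>\<xi>\<close> and \<open>E\<^sub>\<eta> D\<^sub>\<eta> = \<partial>/\<partial>w\<close>, the
  conservation law implies \<open>D\<^sub>\<xi> (E\<^sub>\<eta> P^) = -\<partial>Q^/\<partial>w\<close> and \<open>D\<^sub>\<eta> (E\<^sub>\<xi> Q^) = -\<partial>P^/\<partial>w\<close>.  Two
  consequences follow.  First, \<open>\<mu>^\<close> does not depend on \<open>w\<close> and \<open>D\<^sub>\<xi> D\<^sub>\<eta> \<mu>^ = 0\<close>, so that \<open>\<mu>^\<close> is a
  function of \<open>\<eta>, w\<^sub>0\<^sub>l\<close> plus a function of \<open>\<xi>, w\<^sub>k\<^sub>0\<close>; both summands are, up to a constant, obtained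
  from \<open>\<mu>^\<close> by freezing the other variables at their values at the base point
  (\<open>split_by_freezing\<close>).  Secondly, \<open>E\<^sub>\<eta> P^ + K\<close> with \<open>K = E\<^sub>\<xi> Q^\<close> equals the sum \<open>E\<^sub>\<eta>\<close> of
  \<open>P^ + w\<^sub>0\<^sub>1 K\<close> in which \<open>D\<^sub>\<eta>\<close> is replaced by the operator without the term
  \<open>w\<^sub>0\<^sub>1 \<partial>/\<partial>w\<close> (\<open>euler_line_eq_reduced\<close>).  Freezing commutes with that operator, so
  \<open>P^ + w\<^sub>0\<^sub>1 K\<close> with \<open>\<xi>, w, w\<^sub>k\<^sub>0\<close> frozen serves as \<open>F\<close>; the function \<open>G\<close> arises in the same way, and
  the constant is the Euler sum of a multiple of \<open>w\<^sub>0\<^sub>1\<close> (\<open>on_shell_characteristic_form\<close>).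

  The other parts are short.  A function of the distinguished form is a characteristic by integration
  by parts (\<open>euler_reduced_divergence\<close>).  If it vanishes on solutions, it vanishes, because it does not
  involve \<open>w\<^sub>k\<^sub>l\<close> with \<open>k, l \<ge> 1\<close> and a point can be moved into the solution set by freezing these
  variables.  Characteristics coincide with variational symmetries since the prolongation applied to the
  Lagrangian differs from \<open>\<mu> w\<^sub>1\<^sub>1\<close> by a total divergence (\<open>prolongation_eq_characteristic\<close>).

  Local identities become global ones as follows.  All functions are restricted to a
  small box around the base point and set to \<open>0\<close> outside it.  Identities of germs then are equalities of
  functions, all the differential operators are sums \<open>\<Sum> v\<^sub>c \<partial>/\<partial>c\<close> over jet variables, and boxes are
  preserved by freezing.
\<close>

section \<open>Smooth functions on a box\<close>

text \<open>
  Both mixed derivatives, taken at points that approach \<open>(a, b)\<close>, are equal to the same second difference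
  quotient of \<open>f\<close> over a shrinking square, by two applications of the mean value theorem in either order.
\<close>

lemma mixed_derivatives_commute:
  fixes f fx fy fxy fyx :: "real \<Rightarrow> real \<Rightarrow> real"
  assumes r: "r > 0"
    and fx: "\<And>s t. \<bar>s - a\<bar> < r \<Longrightarrow> \<bar>t - b\<bar> < r \<Longrightarrow> ((\<lambda>s. f s t) has_real_derivative fx s t) (at s)"
    and fy: "\<And>s t. \<bar>s - a\<bar> < r \<Longrightarrow> \<bar>t - b\<bar> < r \<Longrightarrow> ((\<lambda>t. f s t) has_real_derivative fy s t) (at t)"
    and fxy: "\<And>s t. \<bar>s - a\<bar> < r \<Longrightarrow> \<bar>t - b\<bar> < r \<Longrightarrow> ((\<lambda>t. fx s t) has_real_derivative fxy s t) (at t)"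
    and fyx: "\<And>s t. \<bar>s - a\<bar> < r \<Longrightarrow> \<bar>t - b\<bar> < r \<Longrightarrow> ((\<lambda>s. fy s t) has_real_derivative fyx s t) (at s)"
    and cxy: "isCont (\<lambda>z. fxy (fst z) (snd z)) (a, b)"
    and cyx: "isCont (\<lambda>z. fyx (fst z) (snd z)) (a, b)"
  shows "fxy a b = fyx a b"
proof -
  define h :: "nat \<Rightarrow> real" where "h = (\<lambda>n. r / (n + 2))"
  have h: "0 < h n" "h n < r" for n
    using r by (auto simp: h_def field_simps intro: add_pos_nonneg)
  have h0: "h \<longlonglongrightarrow> 0" unfolding h_def by (rule real_tendsto_divide_at_top[OF tendsto_const]) (auto intro!: filterlim_tendsto_add_at_top filterlim_real_sequentially simp: add.commute[of _ 2])
  \<comment> \<open>\<open>?D\<close> below is the second difference over the square of side \<open>h n\<close> at \<open>(a, b)\<close>.\<close>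
  have "\<exists>s t s' t'. a < s \<and> s < a + h n \<and> b < t \<and> t < b + h n \<and> a < s' \<and> s' < a + h n
      \<and> b < t' \<and> t' < b + h n \<and> fxy s t = fyx s' t'" for n
  proof -
    note hn = h[of n]
    let ?D = "f (a + h n) (b + h n) - f (a + h n) b - f a (b + h n) + f a b"
    have "\<exists>s. a < s \<and> s < a + h n \<and> (f (a + h n) (b + h n) - f (a + h n) b) - (f a (b + h n) - f a b)
        = (a + h n - a) * (fx s (b + h n) - fx s b)"
      using hn by (intro MVT2[where f = "\<lambda>s. f s (b + h n) - f s b"]) (auto intro!: derivative_intros fx)
    then obtain s where s: "a < s" "s < a + h n" "?D = h n * (fx s (b + h n) - fx s b)" by auto
    have "\<exists>t. b < t \<and> t < b + h n \<and> fx s (b + h n) - fx s b = (b + h n - b) * fxy s t"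
      using hn s by (intro MVT2) (auto intro!: fxy)
    then obtain t where t: "b < t" "t < b + h n" "?D = h n * h n * fxy s t" using s by auto
    have "\<exists>t. b < t \<and> t < b + h n \<and> (f (a + h n) (b + h n) - f a (b + h n)) - (f (a + h n) b - f a b)
        = (b + h n - b) * (fy (a + h n) t - fy a t)"
      using hn by (intro MVT2[where f = "\<lambda>t. f (a + h n) t - f a t"]) (auto intro!: derivative_intros fy)
    then obtain t' where t': "b < t'" "t' < b + h n" "?D = h n * (fy (a + h n) t' - fy a t')" by auto
    have "\<exists>s. a < s \<and> s < a + h n \<and> fy (a + h n) t' - fy a t' = (a + h n - a) * fyx s t'"
      using hn t' by (intro MVT2) (auto intro!: fyx)
    then obtain s' where s': "a < s'" "s' < a + h n" "?D = h n * h n * fyx s' t'" using t' by auto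
    have "fxy s t = fyx s' t'" using t(3) s'(3) hn by simp
    then show ?thesis using s t s' t' by blast
  qed
  then obtain s t s' t' where st: "\<And>n. a < s n" "\<And>n. s n < a + h n" "\<And>n. b < t n" "\<And>n. t n < b + h n"
      "\<And>n. a < s' n" "\<And>n. s' n < a + h n" "\<And>n. b < t' n" "\<And>n. t' n < b + h n"
      "\<And>n. fxy (s n) (t n) = fyx (s' n) (t' n)"
    by metis
  have squeeze: "u \<longlonglongrightarrow> d" if "\<And>n. d < u n" "\<And>n. u n < d + h n" for u d
  proof -
    have "(\<lambda>n. d + h n) \<longlonglongrightarrow> d" using tendsto_add[OF tendsto_const h0] by simp
    moreover have "\<forall>\<^sub>F n in sequentially. d \<le> u n" "\<forall>\<^sub>F n in sequentially. u n \<le> d + h n"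
      using that by (simp_all add: less_imp_le)
    ultimately show ?thesis
      by (rule tendsto_sandwich[where f = "\<lambda>_. d" and h = "\<lambda>n. d + h n", OF _ _ tendsto_const, rotated 2])
  qed
  have "(\<lambda>n. fxy (s n) (t n)) \<longlonglongrightarrow> fxy a b"
    using isCont_tendsto_compose[OF cxy, of "\<lambda>n. (s n, t n)" sequentially] squeeze st
    by (auto intro!: tendsto_Pair)
  moreover have "(\<lambda>n. fyx (s' n) (t' n)) \<longlonglongrightarrow> fyx a b"
    using isCont_tendsto_compose[OF cyx, of "\<lambda>n. (s' n, t' n)" sequentially] squeeze st
    by (auto intro!: tendsto_Pair)
  ultimately show ?thesis using st(9) LIMSEQ_unique by auto
qed

lemma sum_fun_apply [simp]: "(\<Sum>i\<in>I. f i) x = (\<Sum>i\<in>I. f i x)" for f :: "'i \<Rightarrow> 'a \<Rightarrow> 'b::comm_monoid_add"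
  by (induction I rule: infinite_finite_induct) auto

lemma continuous_on_fun_upd: "continuous_on UNIV (\<lambda>t. x(c := t))" for x :: jet
proof (rule continuous_on_coordinatewise_then_product)
  show "continuous_on UNIV (\<lambda>t. (x(c := t)) d)" for d by (cases "d = c") auto
qed

lemma eventually_fun_upd_in:
  fixes x :: jet
  assumes "open U" "x(c := s) \<in> U"
  shows "\<forall>\<^sub>F t in nhds s. x(c := t) \<in> U"
proof -
  have "open ((\<lambda>t. x(c := t)) -` U)"
    by (rule open_vimage[OF assms(1) continuous_on_fun_upd])
  then show ?thesis using assms(2) by (auto simp: eventually_nhds)
qed

lemma pd_cong_open:
  assumes "open U" "x \<in> U" "\<And>y. y \<in> U \<Longrightarrow> f y = g y"
  shows "pd c f x = pd c g x"
  unfolding pd_def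
  by (rule deriv_cong_ev) (use eventually_fun_upd_in[of U x c "x c"] assms in \<open>auto elim: eventually_mono\<close>)

text \<open>
  Boxes are the neighbourhoods of choice since they are stable under moving single coordinates
  towards those of \<open>p\<close>, which freezing and integration along coordinate lines need.
\<close>

locale jet_box =
  fixes p :: jet and B :: "jet set"
  assumes box: "\<exists>S e. finite S \<and> 0 < e \<and> B = {x. \<forall>c\<in>S. \<bar>x c - p c\<bar> < e}"

lemma box_in_open:
  assumes "open U" "p \<in> U"
  shows "\<exists>B\<subseteq>U. jet_box p B"
proof -
  from assms(1) have "openin (product_topology (\<lambda>i. euclidean) UNIV) U"
    by (simp add: open_fun_def)
  from product_topology_open_contains_basis[OF this assms(2)] obtain Y where
    Y: "p \<in> Pi\<^sub>E UNIV Y" "\<And>c. openin euclidean (Y c)" "finite {c. Y c \<noteq> topspace euclidean}"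
       "Pi\<^sub>E UNIV Y \<subseteq> U" by auto
  define S where "S = {c. Y c \<noteq> UNIV}"
  have fin: "finite S" using Y(3) by (simp add: S_def)
  have "\<exists>e>0. ball (p c) e \<subseteq> Y c" for c
    using Y(1,2) by (auto simp: open_contains_ball PiE_iff)
  then obtain e where e: "\<And>c. e c > 0" "\<And>c. ball (p c) (e c) \<subseteq> Y c" by metis
  define d where "d = Min (insert 1 (e ` S))"
  have d: "d > 0" "c \<in> S \<Longrightarrow> d \<le> e c" for c using fin e(1) by (auto simp: d_def)
  have "{x. \<forall>c\<in>S. \<bar>x c - p c\<bar> < d} \<subseteq> U"
  proof
    fix x assume x: "x \<in> {x. \<forall>c\<in>S. \<bar>x c - p c\<bar> < d}"
    have "x c \<in> Y c" for c
    proof (cases "c \<in> S")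
      case True
      then have "x c \<in> ball (p c) (e c)" using x d(2)[of c] by (auto simp: dist_real_def)
      then show ?thesis using e by blast
    qed (auto simp: S_def)
    then show "x \<in> U" using Y(4) by auto
  qed
  then show ?thesis using fin d by (intro exI[of _ "{x. \<forall>c\<in>S. \<bar>x c - p c\<bar> < d}"]) (auto simp: jet_box_def)
qed

context jet_box
begin

lemma open_B: "open B"
proof -
  obtain S e where S: "finite S" "B = {x. \<forall>c\<in>S. \<bar>x c - p c\<bar> < e}" using box by blast
  have "B = (\<Inter>c\<in>S. {x. \<bar>x c - p c\<bar> < e})" using S by auto
  moreover have "open {x::jet. \<bar>x c - p c\<bar> < e}" for c
    by (intro open_Collect_less continuous_intros continuous_on_product_coordinates)
  ultimately show ?thesis using S by auto
qed

lemma p_in_B: "p \<in> B"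
  using box by auto

lemma B_between:
  assumes "x \<in> B" "\<And>c. \<bar>y c - p c\<bar> \<le> \<bar>x c - p c\<bar>"
  shows "y \<in> B"
  using box assms by (auto intro: le_less_trans)

text \<open>
  Extension by \<open>0\<close> outside the box turns equality on \<open>B\<close> into equality of functions.
\<close>

definition cut :: "(jet \<Rightarrow> real) \<Rightarrow> jet \<Rightarrow> real"
  where "cut f x = (if x \<in> B then f x else 0)"

definition box_functions :: "(jet \<Rightarrow> real) set"
  where "box_functions = {f. (\<forall>x. x \<notin> B \<longrightarrow> f x = 0) \<and> jet_smooth_on B f \<and>
    (\<exists>S. finite S \<and> depends_only_on B S f)}"

definition part :: "coord \<Rightarrow> (jet \<Rightarrow> real) \<Rightarrow> jet \<Rightarrow> real"
  where "part c f = cut (pd c f)"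

definition frozen :: "coord set \<Rightarrow> jet \<Rightarrow> jet"
  where "frozen A x = (\<lambda>c. if c \<in> A then p c else x c)"

definition freeze :: "coord set \<Rightarrow> (jet \<Rightarrow> real) \<Rightarrow> jet \<Rightarrow> real"
  where "freeze A f = cut (\<lambda>x. f (frozen A x))"

definition jet_var :: "coord \<Rightarrow> jet \<Rightarrow> real"
  where "jet_var c = cut (\<lambda>x. x c)"

definition const :: "real \<Rightarrow> jet \<Rightarrow> real"
  where "const a = cut (\<lambda>_. a)"

lemma cut_in [simp]: "x \<in> B \<Longrightarrow> cut f x = f x"
  and cut_out [simp]: "x \<notin> B \<Longrightarrow> cut f x = 0"
  by (simp_all add: cut_def)

lemma cut_eqI: "(\<And>x. x \<in> B \<Longrightarrow> f x = g x) \<Longrightarrow> cut f = cut g"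
  by (auto simp: cut_def)

lemma frozen_in_B: "x \<in> B \<Longrightarrow> frozen A x \<in> B"
  by (erule B_between) (auto simp: frozen_def)

lemma pd_cong: "x \<in> B \<Longrightarrow> (\<And>y. y \<in> B \<Longrightarrow> f y = g y) \<Longrightarrow> pd c f x = pd c g x"
  using pd_cong_open[OF open_B] by blast

lemma part_cong: "(\<And>y. y \<in> B \<Longrightarrow> f y = g y) \<Longrightarrow> part c f = part c g"
  unfolding part_def by (intro cut_eqI pd_cong)

lemma foldr_pd_cong: "(\<And>y. y \<in> B \<Longrightarrow> f y = g y) \<Longrightarrow> x \<in> B \<Longrightarrow> foldr pd cs f x = foldr pd cs g x"
  by (induction cs arbitrary: x) (auto intro: pd_cong)

lemma line_differentiable_cong:
  fixes f g :: "jet \<Rightarrow> real"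
  assumes "x \<in> B" "\<And>y. y \<in> B \<Longrightarrow> f y = g y" "(\<lambda>t. f (x(c := t))) differentiable at (x c)"
  shows "(\<lambda>t. g (x(c := t))) differentiable at (x c)"
proof -
  have "\<forall>\<^sub>F t in nhds (x c). f (x(c := t)) = g (x(c := t))"
    using eventually_fun_upd_in[OF open_B, of x c "x c"] assms(1,2) by (auto elim: eventually_mono)
  from DERIV_cong_ev[OF refl this refl] show ?thesis
    using assms(3) unfolding real_differentiable_def by simp
qed

lemma jet_smooth_cong:
  assumes "\<And>y. y \<in> B \<Longrightarrow> f y = g y" "jet_smooth_on B f"
  shows "jet_smooth_on B g"
  unfolding jet_smooth_on_def
proof (intro allI conjI ballI)
  fix cs
  have *: "foldr pd cs f y = foldr pd cs g y" if "y \<in> B" for y using foldr_pd_cong assms(1) that by blast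
  show "continuous_on B (foldr pd cs g)"
    using assms(2) * unfolding jet_smooth_on_def by (metis (no_types, lifting) continuous_on_cong)
  show "(\<lambda>t. foldr pd cs g (x(c := t))) differentiable at (x c)" if "x \<in> B" for x c
  proof (rule line_differentiable_cong[OF that *])
    show "(\<lambda>t. foldr pd cs f (x(c := t))) differentiable at (x c)"
      using assms(2) that unfolding jet_smooth_on_def by simp
  qed
qed

text \<open>
  A coinductive principle: a class of continuous, partially differentiable functions that is closed under
  partial derivatives consists of smooth functions.
\<close>

lemma jet_smooth_onI:
  assumes f: "f \<in> F"
    and cont: "\<And>f. f \<in> F \<Longrightarrow> continuous_on B f"
    and diff: "\<And>f x c. f \<in> F \<Longrightarrow> x \<in> B \<Longrightarrow> (\<lambda>t. f (x(c := t))) differentiable at (x c)"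
    and part: "\<And>f c. f \<in> F \<Longrightarrow> part c f \<in> F"
  shows "jet_smooth_on B f"
proof -
  have ex: "\<exists>g\<in>F. \<forall>x\<in>B. foldr pd cs f x = g x" for cs
  proof (induction cs)
    case Nil
    then show ?case using f by auto
  next
    case (Cons c cs)
    then obtain g where g: "g \<in> F" "\<forall>x\<in>B. foldr pd cs f x = g x" by blast
    then have "\<forall>x\<in>B. foldr pd (c # cs) f x = part c g x"
      by (auto simp: part_def intro: pd_cong)
    then show ?case using part[OF g(1)] by blast
  qed
  show ?thesis unfolding jet_smooth_on_def
  proof (intro allI conjI ballI)
    fix cs
    obtain g where g: "g \<in> F" "\<forall>x\<in>B. foldr pd cs f x = g x" using ex by blast
    show "continuous_on B (foldr pd cs f)" using cont[OF g(1)] g(2) by (metis (no_types, lifting) continuous_on_cong)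
    show "(\<lambda>t. foldr pd cs f (x(c := t))) differentiable at (x c)" if "x \<in> B" for x c
      by (rule line_differentiable_cong[OF that _ diff[OF g(1) that]]) (use g in auto)
  qed
qed

lemma box_functionsI:
  "f \<in> box_functions" if "\<And>x. x \<notin> B \<Longrightarrow> f x = 0" "jet_smooth_on B f" "finite S" "depends_only_on B S f"
  using that by (auto simp: box_functions_def)

lemma box_functionsE:
  assumes "f \<in> box_functions"
  obtains S where "\<And>x. x \<notin> B \<Longrightarrow> f x = 0" "jet_smooth_on B f" "finite S" "depends_only_on B S f"
  using assms by (auto simp: box_functions_def)

lemma box_functions_outside: "f \<in> box_functions \<Longrightarrow> x \<notin> B \<Longrightarrow> f x = 0"
  by (auto elim: box_functionsE)

lemma cut_id [simp]: "f \<in> box_functions \<Longrightarrow> cut f = f"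
  by (auto simp: cut_def box_functions_outside)

lemma continuous_box: "f \<in> box_functions \<Longrightarrow> continuous_on B f"
  by (elim box_functionsE) (auto simp: jet_smooth_on_def dest: spec[of _ "[]"])

lemma differentiable_box: "f \<in> box_functions \<Longrightarrow> x \<in> B \<Longrightarrow> (\<lambda>t. f (x(c := t))) differentiable at (x c)"
  by (elim box_functionsE) (auto simp: jet_smooth_on_def dest: spec[of _ "[]"])

lemma DERIV_box:
  "f \<in> box_functions \<Longrightarrow> x(c := s) \<in> B \<Longrightarrow>
    ((\<lambda>t. f (x(c := t))) has_real_derivative part c f (x(c := s))) (at s)"
  using differentiable_box[of f "x(c := s)" c]
  by (auto simp: part_def pd_def DERIV_deriv_iff_real_differentiable)

lemma part_eqI:
  assumes "g \<in> box_functions \<or> (\<forall>x. x \<notin> B \<longrightarrow> g x = 0)"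
    "\<And>x. x \<in> B \<Longrightarrow> ((\<lambda>t. f (x(c := t))) has_real_derivative g x) (at (x c))"
  shows "part c f = g"
proof
  fix x show "part c f x = g x"
    by (cases "x \<in> B") (use assms in \<open>auto simp: box_functions_outside part_def pd_def intro!: DERIV_imp_deriv\<close>)
qed

lemma part_eq_0_if_depends:
  assumes "depends_only_on B S f" "c \<notin> S"
  shows "part c f = 0"
proof (rule part_eqI)
  fix x assume x: "x \<in> B"
  have "\<forall>\<^sub>F t in nhds (x c). f (x(c := t)) = f x"
  proof (rule eventually_mono)
    show "\<forall>\<^sub>F t in nhds (x c). x(c := t) \<in> B"
      using eventually_fun_upd_in[OF open_B, of x c "x c"] x by simp
    show "f (x(c := t)) = f x" if "x(c := t) \<in> B" for t
    proof -
      have "\<forall>d\<in>S. (x(c := t)) d = x d" using assms(2) by auto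
      then show ?thesis using assms(1) x that unfolding depends_only_on_def by blast
    qed
  qed
  then show "((\<lambda>t. f (x(c := t))) has_real_derivative 0 x) (at (x c))"
    using DERIV_cong_ev[of "x c" "x c" "\<lambda>t. f (x(c := t))" "\<lambda>_. f x" 0 0] by auto
qed auto

lemma depends_part:
  assumes "depends_only_on B S f"
  shows "depends_only_on B S (part c f)"
  unfolding depends_only_on_def
proof (intro ballI impI)
  fix x y assume xy: "x \<in> B" "y \<in> B" "\<forall>c\<in>S. x c = y c"
  show "part c f x = part c f y"
  proof (cases "c \<in> S")
    case True
    then have "x c = y c" using xy by auto
    have "\<forall>\<^sub>F t in nhds (x c). x(c := t) \<in> B" "\<forall>\<^sub>F t in nhds (x c). y(c := t) \<in> B"
      using eventually_fun_upd_in[OF open_B, of x c "x c"] eventually_fun_upd_in[OF open_B, of y c "x c"]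
        xy(1,2) \<open>x c = y c\<close> by (simp_all only: fun_upd_triv) (simp add: fun_upd_idem)
    then have "\<forall>\<^sub>F t in nhds (x c). f (x(c := t)) = f (y(c := t))"
    proof eventually_elim
      case (elim t)
      have "\<forall>d\<in>S. (x(c := t)) d = (y(c := t)) d" using xy by auto
      then show ?case using assms elim unfolding depends_only_on_def by blast
    qed
    then show ?thesis using xy \<open>x c = y c\<close> by (auto simp: part_def pd_def intro!: deriv_cong_ev)
  qed (use part_eq_0_if_depends[OF assms] in auto)
qed

lemma part_closed [simp, intro]:
  assumes "f \<in> box_functions"
  shows "part c f \<in> box_functions"
proof -
  obtain S where S: "jet_smooth_on B f" "finite S" "depends_only_on B S f" using assms by (auto elim: box_functionsE)
  show ?thesis
  proof (rule box_functionsI)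
    have "jet_smooth_on B (pd c f)"
      unfolding jet_smooth_on_def
    proof
      fix cs
      have "foldr pd (cs @ [c]) f = foldr pd cs (pd c f)" by simp
      then show "continuous_on B (foldr pd cs (pd c f)) \<and>
          (\<forall>x\<in>B. \<forall>d. (\<lambda>t. foldr pd cs (pd c f) (x(d := t))) differentiable at (x d))"
        using S(1) unfolding jet_smooth_on_def by metis
    qed
    then show "jet_smooth_on B (part c f)" by (rule jet_smooth_cong[rotated]) (auto simp: part_def)
  qed (use S depends_part in \<open>auto simp: part_def\<close>)
qed

lemma part_const [simp]: "part c (const a) = 0"
  by (rule part_eq_0_if_depends[of "{}"]) (auto simp: depends_only_on_def const_def)

lemma part_0 [simp]: "part c 0 = 0"
  by (rule part_eq_0_if_depends[of "{}"]) (auto simp: depends_only_on_def)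

lemma zero_eq_const: "0 = const 0"
  by (auto simp: const_def cut_def)

lemma const_closed [simp, intro]: "const a \<in> box_functions"
proof (rule box_functionsI[of _ "{}"])
  show "jet_smooth_on B (const a)"
  proof (rule jet_smooth_onI[of _ "range const"])
    fix f assume f: "f \<in> range const"
    then obtain b where b: "f = const b" by auto
    show "continuous_on B f" using continuous_on_cong[of B B f "\<lambda>_. b"] by (auto simp: b const_def)
    show "part c f \<in> range const" for c using b zero_eq_const by simp
    show "(\<lambda>t. f (x(c := t))) differentiable at (x c)" if "x \<in> B" for x c
      by (rule line_differentiable_cong[OF that, of "\<lambda>_. b"]) (auto simp: b const_def)
  qed auto
qed (auto simp: const_def depends_only_on_def)

lemma zero_closed [simp, intro]: "0 \<in> box_functions"
  by (simp add: zero_eq_const)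

lemma part_jet_var: "part c (jet_var d) = (if c = d then const 1 else 0)"
proof (rule part_eqI)
  fix x assume "x \<in> B"
  have "\<forall>\<^sub>F t in nhds (x c). jet_var d (x(c := t)) = (x(c := t)) d"
    using eventually_fun_upd_in[OF open_B, of x c "x c"] \<open>x \<in> B\<close>
    by (auto elim!: eventually_mono simp: jet_var_def)
  moreover have "((\<lambda>t. (x(c := t)) d) has_real_derivative (if c = d then const 1 else 0) x) (at (x c))"
    using \<open>x \<in> B\<close> by (auto simp: const_def)
  ultimately show "((\<lambda>t. jet_var d (x(c := t))) has_real_derivative (if c = d then const 1 else 0) x) (at (x c))"
    by (subst DERIV_cong_ev[OF refl _ refl])
qed auto

lemma jet_var_closed [simp, intro]: "jet_var d \<in> box_functions"
proof (rule box_functionsI[of _ "{d}"])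
  show "jet_smooth_on B (jet_var d)"
  proof (rule jet_smooth_onI[of _ "insert (jet_var d) (range const)"])
    fix f assume f: "f \<in> insert (jet_var d) (range const)"
    have Xc: "continuous_on B (jet_var d)"
      using continuous_on_cong[of B B "jet_var d" "\<lambda>x. x d"] continuous_on_product_coordinates[of d]
        continuous_on_subset[OF continuous_on_product_coordinates[of d] subset_UNIV]
      by (auto simp: jet_var_def)
    have Xd: "(\<lambda>t. jet_var d (x(c := t))) differentiable at (x c)" if "x \<in> B" for x c
      by (rule line_differentiable_cong[OF that, of "\<lambda>x. x d"]) (cases "c = d"; auto simp: jet_var_def)+
    show "continuous_on B f" using f Xc by (auto intro: continuous_box)
    show "part c f \<in> insert (jet_var d) (range const)" for c using f zero_eq_const by (auto simp: part_jet_var)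
    show "(\<lambda>t. f (x(c := t))) differentiable at (x c)" if "x \<in> B" for x c
      using f Xd[OF that] differentiable_box[OF _ that] by auto
  qed auto
qed (auto simp: jet_var_def depends_only_on_def)

lemma part_add:
  assumes "f \<in> box_functions" "g \<in> box_functions"
  shows "part c (f + g) = part c f + part c g"
proof (rule part_eqI)
  fix x assume "x \<in> B"
  then show "((\<lambda>t. (f + g) (x(c := t))) has_real_derivative (part c f + part c g) x) (at (x c))"
    using DERIV_add[OF DERIV_box[OF assms(1), of x c "x c"] DERIV_box[OF assms(2), of x c "x c"]]
    by simp
qed (use assms in \<open>auto simp: box_functions_outside\<close>)

lemma part_mult:
  assumes "f \<in> box_functions" "g \<in> box_functions"
  shows "part c (f * g) = part c f * g + f * part c g"
proof (rule part_eqI)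
  fix x assume "x \<in> B"
  then show "((\<lambda>t. (f * g) (x(c := t))) has_real_derivative (part c f * g + f * part c g) x) (at (x c))"
    using DERIV_mult'[OF DERIV_box[OF assms(1), of x c "x c"] DERIV_box[OF assms(2), of x c "x c"]]
    by (simp add: algebra_simps)
qed (use assms in \<open>auto simp: box_functions_outside\<close>)

text \<open>
  The Leibniz rule leads from products to sums of products, so this is the class to which
  \<open>jet_smooth_onI\<close> applies for proving that products are smooth.
\<close>

inductive_set sums_of_products :: "(jet \<Rightarrow> real) set" where
  base: "f \<in> box_functions \<Longrightarrow> g \<in> box_functions \<Longrightarrow> f * g \<in> sums_of_products"
| add: "f \<in> sums_of_products \<Longrightarrow> g \<in> sums_of_products \<Longrightarrow> f + g \<in> sums_of_products"

lemma sums_of_products_smooth: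
  assumes "f \<in> sums_of_products"
  shows "jet_smooth_on B f"
proof (rule jet_smooth_onI[OF assms])
  have *: "continuous_on B f \<and> (\<forall>x\<in>B. \<forall>c. (\<lambda>t. f (x(c := t))) differentiable at (x c))
      \<and> (\<forall>c. part c f \<in> sums_of_products)" if "f \<in> sums_of_products" for f
    using that
  proof induction
    case (base f g)
    have "part c (f * g) \<in> sums_of_products" for c
      using base by (auto simp: part_mult intro!: sums_of_products.intros)
    moreover have "continuous_on B (f * g)"
      using continuous_on_mult[OF continuous_box[OF base(1)] continuous_box[OF base(2)]]
      by (simp add: times_fun_def)
    moreover have "(\<lambda>t. (f * g) (x(c := t))) differentiable at (x c)" if "x \<in> B" for x c
      using differentiable_mult[OF differentiable_box[OF base(1) that] differentiable_box[OF base(2) that]]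
      by simp
    ultimately show ?case by blast
  next
    case (add f g)
    have "part c (f + g) = part c f + part c g" for c
    proof (rule part_eqI)
      have out: "f x = 0" if "f \<in> sums_of_products" "x \<notin> B" for f x
        using that by induction (auto simp: box_functions_outside)
      show "part c f + part c g \<in> box_functions \<or> (\<forall>x. x \<notin> B \<longrightarrow> (part c f + part c g) x = 0)"
        by (auto simp: part_def)
      fix x assume x: "x \<in> B"
      have "((\<lambda>t. h (x(c := t))) has_real_derivative part c h x) (at (x c))" if "h \<in> {f, g}" for h
        using add that x unfolding part_def pd_def cut_in[OF x] DERIV_deriv_iff_real_differentiable by blast
      then show "((\<lambda>t. (f + g) (x(c := t))) has_real_derivative (part c f + part c g) x) (at (x c))"
        by (auto intro!: derivative_eq_intros)
    qed
    moreover have "continuous_on B (f + g)"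
      using continuous_on_add[of B f g] add by (simp add: plus_fun_def)
    moreover have "(\<lambda>t. (f + g) (x(c := t))) differentiable at (x c)" if "x \<in> B" for x c
    proof -
      have "(\<lambda>t. f (x(c := t))) differentiable at (x c)" "(\<lambda>t. g (x(c := t))) differentiable at (x c)"
        using add that by blast+
      from differentiable_add[OF this] show ?thesis by simp
    qed
    ultimately show ?case using add by (metis sums_of_products.add)
  qed
  fix f assume f: "f \<in> sums_of_products"
  show "continuous_on B f" "part c f \<in> sums_of_products" for c using *[OF f] by auto
  show "(\<lambda>t. f (x(c := t))) differentiable at (x c)" if "x \<in> B" for x c using *[OF f] that by auto
qed

lemma const_1_mult [simp]: "f \<in> box_functions \<Longrightarrow> const 1 * f = f" "f \<in> box_functions \<Longrightarrow> f * const 1 = f"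
  by (auto simp: fun_eq_iff const_def cut_def box_functions_outside)

lemma depends_combine:
  assumes "depends_only_on B S f" "depends_only_on B T g"
  shows "depends_only_on B (S \<union> T) (\<lambda>x. h (f x) (g x))"
  using assms unfolding depends_only_on_def by (metis UnCI)

lemma mult_closed [simp, intro]:
  assumes "f \<in> box_functions" "g \<in> box_functions"
  shows "f * g \<in> box_functions"
proof -
  obtain S T where "finite S" "depends_only_on B S f" "finite T" "depends_only_on B T g"
    using assms by (auto elim!: box_functionsE)
  then show ?thesis
    using assms depends_combine[of S f T g "(*)"] sums_of_products_smooth[OF sums_of_products.base[OF assms]]
    by (auto intro!: box_functionsI[of _ "S \<union> T"] simp: times_fun_def box_functions_outside)
qed

lemma add_closed [simp, intro]:
  assumes "f \<in> box_functions" "g \<in> box_functions"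
  shows "f + g \<in> box_functions"
proof -
  obtain S T where "finite S" "depends_only_on B S f" "finite T" "depends_only_on B T g"
    using assms by (auto elim!: box_functionsE)
  moreover have "const 1 * f + const 1 * g \<in> sums_of_products"
    using assms by (intro sums_of_products.intros) auto
  then have "jet_smooth_on B (f + g)" using assms sums_of_products_smooth by simp
  ultimately show ?thesis
    using assms depends_combine[of S f T g "(+)"]
    by (auto intro!: box_functionsI[of _ "S \<union> T"] simp: plus_fun_def box_functions_outside)
qed

lemma uminus_eq_const_mult: "- f = const (- 1) * f" if "f \<in> box_functions"
  using that by (auto simp: fun_eq_iff const_def cut_def box_functions_outside)

lemma uminus_closed [simp, intro]: "f \<in> box_functions \<Longrightarrow> - f \<in> box_functions"
  by (auto simp: uminus_eq_const_mult)

lemma diff_closed [simp, intro]: "f \<in> box_functions \<Longrightarrow> g \<in> box_functions \<Longrightarrow> f - g \<in> box_functions"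
  using add_closed[of f "- g"] by simp

lemma sum_closed [simp, intro]: "(\<And>i. i \<in> I \<Longrightarrow> f i \<in> box_functions) \<Longrightarrow> (\<Sum>i\<in>I. f i) \<in> box_functions"
  by (induction I rule: infinite_finite_induct) auto

lemma part_uminus: "f \<in> box_functions \<Longrightarrow> part c (- f) = - part c f"
  by (simp add: uminus_eq_const_mult part_mult)

lemma part_diff: "f \<in> box_functions \<Longrightarrow> g \<in> box_functions \<Longrightarrow> part c (f - g) = part c f - part c g"
  using part_add[of f "- g"] by (simp add: part_uminus)

lemma part_sum: "(\<And>i. i \<in> I \<Longrightarrow> f i \<in> box_functions) \<Longrightarrow> part c (\<Sum>i\<in>I. f i) = (\<Sum>i\<in>I. part c (f i))"
  by (induction I rule: infinite_finite_induct) (auto simp: part_add)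

lemma part_commute:
  assumes f: "f \<in> box_functions"
  shows "part c (part d f) = part d (part c f)"
proof (cases "c = d")
  case False
  show ?thesis
  proof
    fix x
    show "part c (part d f) x = part d (part c f) x"
    proof (cases "x \<in> B")
      case True
      let ?y = "\<lambda>s t. x(c := s, d := t)"
      have contU: "continuous_on UNIV (\<lambda>z. ?y (fst z) (snd z))"
      proof (rule continuous_on_coordinatewise_then_product)
        show "continuous_on UNIV (\<lambda>z. ?y (fst z) (snd z) i)" for i
          by (cases "i = d"; cases "i = c") (auto intro!: continuous_intros)
      qed
      have "open ((\<lambda>z. ?y (fst z) (snd z)) -` B)"
        by (rule open_vimage[OF open_B contU])
      moreover have "(x c, x d) \<in> (\<lambda>z. ?y (fst z) (snd z)) -` B" using True by simp
      ultimately obtain S T where ST: "open S" "open T" "x c \<in> S" "x d \<in> T"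
          "S \<times> T \<subseteq> (\<lambda>z. ?y (fst z) (snd z)) -` B"
        by (elim open_prod_elim) auto
      obtain r1 where r1: "r1 > 0" "ball (x c) r1 \<subseteq> S" using ST open_contains_ball by blast
      obtain r2 where r2: "r2 > 0" "ball (x d) r2 \<subseteq> T" using ST open_contains_ball by blast
      define r where "r = min r1 r2"
      have r: "?y s t \<in> B" if "\<bar>s - x c\<bar> < r" "\<bar>t - x d\<bar> < r" for s t
      proof -
        have "s \<in> ball (x c) r1" "t \<in> ball (x d) r2"
          using that by (simp_all add: r_def dist_real_def abs_minus_commute)
        then have "s \<in> S" "t \<in> T" using r1 r2 by blast+
        then show ?thesis using ST(5) by auto
      qed
      have comm: "?y s t = x(d := t, c := s)" for s t using False by (auto simp: fun_upd_twist)
      have cont: "isCont (\<lambda>z. g (?y (fst z) (snd z))) (x c, x d)" if "g \<in> box_functions" for g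
      proof -
        let ?V = "(\<lambda>z. ?y (fst z) (snd z)) -` B"
        have "continuous_on ?V (\<lambda>z. g (?y (fst z) (snd z)))"
          by (rule continuous_on_compose2[OF continuous_box[OF that] continuous_on_subset[OF contU]]) auto
        then show ?thesis
          using open_vimage[OF open_B contU] True by (simp add: continuous_on_eq_continuous_at)
      qed
      have d1: "((\<lambda>s. g (?y s t)) has_real_derivative part c g (?y s t)) (at s)"
        if "\<bar>s - x c\<bar> < r" "\<bar>t - x d\<bar> < r" "g \<in> box_functions" for s t g
        using DERIV_box[of g "x(d := t)" c s] r that by (simp add: comm)
      have d2: "((\<lambda>t. g (?y s t)) has_real_derivative part d g (?y s t)) (at t)"
        if "\<bar>s - x c\<bar> < r" "\<bar>t - x d\<bar> < r" "g \<in> box_functions" for s t g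
        using DERIV_box[of g "x(c := s)" d t] r that by simp
      have "part d (part c f) (?y (x c) (x d)) = part c (part d f) (?y (x c) (x d))"
        by (rule mixed_derivatives_commute[where r = r and f = "\<lambda>s t. f (?y s t)" and
              fx = "\<lambda>s t. part c f (?y s t)" and fy = "\<lambda>s t. part d f (?y s t)" and
              fxy = "\<lambda>s t. part d (part c f) (?y s t)" and fyx = "\<lambda>s t. part c (part d f) (?y s t)"])
          (use r1 r2 f in \<open>auto simp: r_def[symmetric] intro!: d1 d2 cont\<close>, auto simp: r_def)
      then show ?thesis by simp
    qed (use f in \<open>auto simp: box_functions_outside\<close>)
  qed
qed auto

end

section \<open>Alternating sums\<close>

text \<open>
  The sum of \<open>(-T)\<^sup>i a\<^sub>i\<close> for \<open>i < n\<close> in Horner form (\<open>alt_sum_eq_sum\<close>).  The Horner form is what the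
  inductions below follow.
\<close>

primrec alt_sum :: "('a::ab_group_add \<Rightarrow> 'a) \<Rightarrow> nat \<Rightarrow> (nat \<Rightarrow> 'a) \<Rightarrow> 'a" where
  "alt_sum T 0 a = 0"
| "alt_sum T (Suc n) a = a 0 - T (alt_sum T n (\<lambda>i. a (Suc i)))"

text \<open>
  The algebraic reason behind \<open>E D = \<partial>/\<partial>w\<close> and behind the reduction of a characteristic to the
  derivatives of its conserved current.
\<close>

lemma alt_sum_telescope: "a n = 0 \<Longrightarrow> alt_sum T n (\<lambda>i. T (a (Suc i)) + a i) = a 0"
proof (induction n arbitrary: a)
  case (Suc n)
  from Suc.IH[of "\<lambda>i. a (Suc i)"] Suc.prems show ?case by simp
qed simp

lemma alt_sum_cong: "(\<And>i. i < n \<Longrightarrow> a i = b i) \<Longrightarrow> alt_sum T n a = alt_sum T n b"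
proof (induction n arbitrary: a b)
  case (Suc n)
  from Suc.IH[of "\<lambda>i. a (Suc i)" "\<lambda>i. b (Suc i)"] Suc.prems show ?case by simp
qed simp

context jet_box
begin

section \<open>Freezing jet variables\<close>

lemma frozen_apply: "frozen A x c = (if c \<in> A then p c else x c)"
  by (simp add: frozen_def)

lemma frozen_upd: "frozen A (x(c := t)) = (if c \<in> A then frozen A x else (frozen A x)(c := t))"
  by (auto simp: frozen_def)

lemma freeze_in: "x \<in> B \<Longrightarrow> freeze A f x = f (frozen A x)"
  by (simp add: freeze_def)

lemma part_freeze_DERIV:
  assumes "f \<in> box_functions" "x \<in> B"
  shows "((\<lambda>t. f (frozen A (x(c := t)))) has_real_derivative
    (if c \<in> A then 0 else freeze A (part c f)) x) (at (x c))"
proof (cases "c \<in> A")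
  case False
  then have "frozen A x = (frozen A x)(c := x c)" by (auto simp: frozen_def)
  then show ?thesis
    using DERIV_box[of f "frozen A x" c "x c"] False frozen_in_B[OF assms(2)] assms
    by (simp add: frozen_upd freeze_in)
qed (simp add: frozen_upd)

lemma part_freeze:
  assumes "f \<in> box_functions"
  shows "part c (freeze A f) = (if c \<in> A then 0 else freeze A (part c f))"
proof -
  have "part c (freeze A f) = part c (\<lambda>x. f (frozen A x))"
    by (rule part_cong) (simp add: freeze_in)
  also have "\<dots> = (if c \<in> A then 0 else freeze A (part c f))"
    by (rule part_eqI) (use part_freeze_DERIV[OF assms] in \<open>auto simp: freeze_def\<close>)
  finally show ?thesis .
qed

lemma continuous_frozen: "continuous_on UNIV (frozen A)"
proof (rule continuous_on_coordinatewise_then_product)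
  show "continuous_on UNIV (\<lambda>x. frozen A x c)" for c
    by (cases "c \<in> A") (auto simp: frozen_def)
qed

lemma freeze_0 [simp]: "freeze A 0 = 0"
  by (auto simp: freeze_def cut_def)

lemma freeze_closed [simp, intro]:
  assumes "f \<in> box_functions"
  shows "freeze A f \<in> box_functions"
proof -
  obtain S where S: "finite S" "depends_only_on B S f" using assms by (auto elim: box_functionsE)
  show ?thesis
  proof (rule box_functionsI)
    show "jet_smooth_on B (freeze A f)"
    proof (rule jet_smooth_onI[of _ "freeze A ` box_functions"])
      fix g assume "g \<in> freeze A ` box_functions"
      then obtain f where f: "f \<in> box_functions" "g = freeze A f" by auto
      have "continuous_on B (\<lambda>x. f (frozen A x))"
        by (rule continuous_on_compose2[OF continuous_box[OF f(1)] continuous_on_subset[OF continuous_frozen]])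
          (auto simp: frozen_in_B)
      then show "continuous_on B g"
        using continuous_on_cong[of B B g "\<lambda>x. f (frozen A x)"] f(2) by (simp add: freeze_in)
      show "(\<lambda>t. g (x(c := t))) differentiable at (x c)" if "x \<in> B" for x c
      proof (rule line_differentiable_cong[OF that])
        show "(\<lambda>t. f (frozen A (x(c := t)))) differentiable at (x c)"
          using part_freeze_DERIV[OF f(1) that] unfolding real_differentiable_def by blast
      qed (simp add: f(2) freeze_in)
      have "0 = freeze A 0" by simp
      then show "part c g \<in> freeze A ` box_functions" for c
        using f by (auto simp: part_freeze simp del: freeze_0)
    qed (use assms in auto)
    show "finite S" by fact
    show "depends_only_on B S (freeze A f)"
      unfolding depends_only_on_def
    proof (intro ballI impI)
      fix x y assume "x \<in> B" "y \<in> B" "\<forall>c\<in>S. x c = y c"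
      moreover from this have "\<forall>c\<in>S. frozen A x c = frozen A y c" by (auto simp: frozen_def)
      ultimately show "freeze A f x = freeze A f y"
        using S(2) frozen_in_B[of x A] frozen_in_B[of y A] unfolding depends_only_on_def
        by (simp only: freeze_in)
    qed
  qed (simp add: freeze_def)
qed

lemma freeze_add: "freeze A (f + g) = freeze A f + freeze A g"
  and freeze_diff: "freeze A (f - g) = freeze A f - freeze A g"
  and freeze_mult: "freeze A (f * g) = freeze A f * freeze A g"
  and freeze_const [simp]: "freeze A (const a) = const a"
  and freeze_jet_var: "freeze A (jet_var c) = (if c \<in> A then const (p c) else jet_var c)"
  by (auto simp: fun_eq_iff freeze_def cut_def const_def jet_var_def frozen_in_B frozen_apply)

text \<open>
  From here on equations between functions are handled algebraically; with the pointwise rules active,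
  the simplifier would expand sums and products under binders.
\<close>

lemmas pointwise = plus_fun_apply times_fun_apply zero_fun_apply one_fun_apply sum_fun_apply
  minus_apply uminus_apply

declare pointwise [simp del]

lemma freeze_freeze: "freeze A (freeze C f) = freeze (A \<union> C) f"
proof
  fix x
  have "frozen C (frozen A x) = frozen (A \<union> C) x" by (auto simp: frozen_def)
  then show "freeze A (freeze C f) x = freeze (A \<union> C) f x"
    by (cases "x \<in> B") (auto simp: freeze_in frozen_in_B freeze_def)
qed

text \<open>
  The segment from \<open>x\<close> to its frozen image stays in the box, and the function is constant along it.
\<close>

lemma frozen_insert_same:
  assumes f: "f \<in> box_functions" "part c f = 0" and x: "x \<in> B"
  shows "f (x(c := p c)) = f x"
proof -
  let ?I = "closed_segment (p c) (x c)"
  have inB: "x(c := t) \<in> B" if "t \<in> ?I" for t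
    by (rule B_between[OF x]) (use that in \<open>auto simp: closed_segment_eq_real_ivl split: if_splits\<close>)
  have "((\<lambda>t. f (x(c := t))) has_real_derivative 0) (at t within ?I)" if "t \<in> ?I" for t
    using DERIV_box[OF f(1) inB[OF that]] f(2) by (auto simp: pointwise intro: has_field_derivative_at_within)
  then obtain k where "\<And>t. t \<in> ?I \<Longrightarrow> f (x(c := t)) = k"
    using has_field_derivative_zero_constant[of ?I "\<lambda>t. f (x(c := t))"] by auto
  from this[of "p c"] this[of "x c"] show ?thesis by simp
qed

text \<open>
  Only finitely many of the frozen variables matter, and these can be frozen one by one.
\<close>

lemma freeze_id:
  assumes f: "f \<in> box_functions" and A: "\<And>c. c \<in> A \<Longrightarrow> part c f = 0"
  shows "freeze A f = f"
proof
  fix x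
  obtain S where S: "finite S" "depends_only_on B S f" using f by (auto elim: box_functionsE)
  show "freeze A f x = f x"
  proof (cases "x \<in> B")
    case True
    have fin: "f (frozen T x) = f x" if "finite T" "T \<subseteq> A" for T
      using that
    proof (induction T)
      case empty
      then show ?case by (simp add: frozen_def)
    next
      case (insert c T)
      have "frozen (insert c T) x = (frozen T x)(c := p c)" by (auto simp: frozen_def)
      moreover have "f ((frozen T x)(c := p c)) = f (frozen T x)"
        using insert by (intro frozen_insert_same f A frozen_in_B True) simp
      ultimately show ?case using insert by (simp only:) simp
    qed
    have "f (frozen A x) = f (frozen (A \<inter> S) x)"
    proof -
      have "\<forall>c\<in>S. frozen A x c = frozen (A \<inter> S) x c" by (auto simp: frozen_def)
      then show ?thesis
        using S(2) frozen_in_B[OF True, of A] frozen_in_B[OF True, of "A \<inter> S"]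
        unfolding depends_only_on_def by blast
    qed
    then show ?thesis using True fin[of "A \<inter> S"] S by (simp add: freeze_in)
  qed (use f in \<open>simp add: freeze_def box_functions_outside\<close>)
qed

lemma depends_if_part_eq_0:
  assumes f: "f \<in> box_functions" and S: "\<And>c. c \<notin> S \<Longrightarrow> part c f = 0"
  shows "depends_only_on B S f"
  unfolding depends_only_on_def
proof (intro ballI impI)
  fix x y assume xy: "x \<in> B" "y \<in> B" "\<forall>c\<in>S. x c = y c"
  have "freeze (- S) f = f" using f S by (intro freeze_id) auto
  moreover have "frozen (- S) x = frozen (- S) y" using xy by (auto simp: frozen_def)
  ultimately show "f x = f y" using xy by (metis freeze_in)
qed

section \<open>Vector fields on the jet space\<close>

text \<open>
  The vector field with coefficients \<open>v c\<close> acting as a derivation; the sum is finite on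
  \<open>box_functions\<close>.
\<close>

definition vfield :: "(coord \<Rightarrow> jet \<Rightarrow> real) \<Rightarrow> (jet \<Rightarrow> real) \<Rightarrow> jet \<Rightarrow> real"
  where "vfield v f = (\<Sum>c | part c f \<noteq> 0. v c * part c f)"

lemma finite_support:
  assumes "f \<in> box_functions"
  shows "finite {c. part c f \<noteq> 0}"
proof -
  obtain S where S: "finite S" "depends_only_on B S f" using assms by (auto elim: box_functionsE)
  then have "{c. part c f \<noteq> 0} \<subseteq> S" using part_eq_0_if_depends by blast
  then show ?thesis using S finite_subset by blast
qed

lemma vfield_eq:
  assumes "finite S" "{c. part c f \<noteq> 0} \<subseteq> S"
  shows "vfield v f = (\<Sum>c\<in>S. v c * part c f)"
  unfolding vfield_def using assms by (intro sum.mono_neutral_left) auto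

lemma vfield_cong: "(\<And>c. part c f \<noteq> 0 \<Longrightarrow> v c = u c) \<Longrightarrow> vfield v f = vfield u f"
  unfolding vfield_def by (auto intro: sum.cong)

lemma vfield_closed [simp, intro]:
  "(\<And>c. v c \<in> box_functions) \<Longrightarrow> f \<in> box_functions \<Longrightarrow> vfield v f \<in> box_functions"
  unfolding vfield_def by auto

lemma vfield_add:
  assumes "f \<in> box_functions" "g \<in> box_functions"
  shows "vfield v (f + g) = vfield v f + vfield v g"
proof -
  let ?S = "{c. part c f \<noteq> 0} \<union> {c. part c g \<noteq> 0}"
  have "finite ?S" using assms finite_support by auto
  then show ?thesis
    using assms
    by (subst (1 2 3) vfield_eq[of ?S]) (auto simp: part_add sum.distrib[symmetric] algebra_simps)
qed

lemma vfield_mult: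
  assumes "f \<in> box_functions" "g \<in> box_functions"
  shows "vfield v (f * g) = vfield v f * g + f * vfield v g"
proof -
  let ?S = "{c. part c f \<noteq> 0} \<union> {c. part c g \<noteq> 0}"
  have "finite ?S" using assms finite_support by auto
  then show ?thesis
    using assms
    by (subst (1 2 3) vfield_eq[of ?S])
      (auto simp: part_mult sum.distrib[symmetric] sum_distrib_left sum_distrib_right algebra_simps)
qed

lemma vfield_0 [simp]: "vfield v 0 = 0"
  by (simp add: vfield_def)

lemma vfield_add_field:
  "vfield (\<lambda>c. v c + u c) f = vfield v f + vfield u f"
  by (simp add: vfield_def sum.distrib algebra_simps)

lemma vfield_jet_var: "v c \<in> box_functions \<Longrightarrow> vfield v (jet_var c) = v c"
  by (subst vfield_eq[of "{c}"]) (auto simp: part_jet_var)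

lemma vfield_const [simp]: "vfield v (const a) = 0"
  by (simp add: vfield_def)

text \<open>
  This is the source of all commutators between partial and total derivatives: only the derivatives of
  the coefficients contribute.
\<close>

lemma part_vfield:
  assumes v: "\<And>c. v c \<in> box_functions" and f: "f \<in> box_functions"
  shows "part d (vfield v f) = vfield v (part d f) + vfield (\<lambda>c. part d (v c)) f"
proof -
  let ?S = "{c. part c f \<noteq> 0}"
  have S: "finite ?S" "{c. part c (part d f) \<noteq> 0} \<subseteq> ?S"
    using finite_support[OF f] part_commute[OF f, of _ d] by auto
  have "part d (vfield v f) = (\<Sum>c\<in>?S. v c * part c (part d f) + part d (v c) * part c f)"
    using v f by (simp add: vfield_def part_sum part_mult part_commute[OF f, of d] add.commute)
  then show ?thesis
    using S by (simp add: sum.distrib vfield_eq[OF S] vfield_def[of _ f])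
qed

text \<open>
  The bracket of two vector fields has the coefficients \<open>v (u\<^sub>c) - u (v\<^sub>c)\<close>, which are zero here.
\<close>

lemma vfield_commute:
  assumes v: "\<And>c. v c \<in> box_functions" and u: "\<And>c. u c \<in> box_functions" and f: "f \<in> box_functions"
    and vu: "\<And>c. vfield v (u c) = 0" and uv: "\<And>c. vfield u (v c) = 0"
  shows "vfield v (vfield u f) = vfield u (vfield v f)"
proof -
  let ?S = "{c. part c f \<noteq> 0}"
  \<comment> \<open>By symmetry of second derivatives, \<open>?S\<close> supports all derivatives of \<open>f\<close> as well.\<close>
  have S: "finite ?S" "{c. part c (part d f) \<noteq> 0} \<subseteq> ?S" for d
    using finite_support[OF f] part_commute[OF f, of _ d] by auto
  have sum: "vfield a (\<Sum>c\<in>I. g c) = (\<Sum>c\<in>I. vfield a (g c))" if "\<And>c. g c \<in> box_functions" for a g I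
    using that by (induction I rule: infinite_finite_induct) (auto simp: vfield_add)
  have *: "vfield a (vfield b f) = (\<Sum>c\<in>?S. \<Sum>d\<in>?S. b c * a d * part d (part c f))"
    if "\<And>c. a c \<in> box_functions" "\<And>c. b c \<in> box_functions" "\<And>c. vfield a (b c) = 0" for a b
    using that f S
    by (simp add: vfield_def[of b] sum vfield_mult vfield_eq[OF S] sum_distrib_left mult.assoc)
  show ?thesis
    unfolding *[OF v u vu] *[OF u v uv]
    by (subst sum.swap) (simp add: part_commute[OF f] mult.commute mult.left_commute)
qed

lemma freeze_vfield:
  assumes f: "f \<in> box_functions"
    and v: "\<And>c. c \<notin> A \<Longrightarrow> freeze A (v c) = v' c" "\<And>c. c \<in> A \<Longrightarrow> freeze A (v c) = 0"
  shows "freeze A (vfield v f) = vfield v' (freeze A f)"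
proof -
  let ?S = "{c. part c f \<noteq> 0}"
  have "finite ?S" "{c. part c (freeze A f) \<noteq> 0} \<subseteq> ?S"
    using finite_support[OF f] f by (auto simp: part_freeze split: if_splits)
  note S = this(1) vfield_eq[OF this]
  have sum: "freeze A (\<Sum>c\<in>I. g c) = (\<Sum>c\<in>I. freeze A (g c))" for g :: "coord \<Rightarrow> jet \<Rightarrow> real" and I
    by (induction I rule: infinite_finite_induct) (auto simp: freeze_add)
  show ?thesis
    unfolding S(2) vfield_def[of _ f] sum
    by (rule sum.cong) (use f v in \<open>auto simp: freeze_mult part_freeze\<close>)
qed

section \<open>Additive operators and their alternating sums\<close>

text \<open>
  Partial derivatives are additive only on differentiable functions, hence the relativized notion.
\<close>

definition additive_op :: "((jet \<Rightarrow> real) \<Rightarrow> jet \<Rightarrow> real) \<Rightarrow> bool"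
  where "additive_op T \<longleftrightarrow> (\<forall>f\<in>box_functions. T f \<in> box_functions) \<and>
    (\<forall>f\<in>box_functions. \<forall>g\<in>box_functions. T (f + g) = T f + T g)"

lemma additive_op_closed: "additive_op T \<Longrightarrow> f \<in> box_functions \<Longrightarrow> T f \<in> box_functions"
  and additive_op_add: "additive_op T \<Longrightarrow> f \<in> box_functions \<Longrightarrow> g \<in> box_functions \<Longrightarrow> T (f + g) = T f + T g"
  by (auto simp: additive_op_def)

lemma additive_op_0: "additive_op T \<Longrightarrow> T 0 = 0"
  using additive_op_add[of T 0 0] by simp

lemma additive_op_uminus: "additive_op T \<Longrightarrow> f \<in> box_functions \<Longrightarrow> T (- f) = - T f"
  using additive_op_add[of T "- f" f] additive_op_0[of T] by (simp add: eq_neg_iff_add_eq_0)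

lemma additive_op_diff:
  "additive_op T \<Longrightarrow> f \<in> box_functions \<Longrightarrow> g \<in> box_functions \<Longrightarrow> T (f - g) = T f - T g"
  using additive_op_add[of T f "- g"] additive_op_uminus[of T g] by simp

lemma additive_part: "additive_op (part c)"
  and additive_freeze: "additive_op (freeze A)"
  and additive_vfield: "(\<And>c. v c \<in> box_functions) \<Longrightarrow> additive_op (vfield v)"
  by (auto simp: additive_op_def part_add freeze_add vfield_add)

lemma alt_sum_closed:
  "additive_op T \<Longrightarrow> (\<And>i. a i \<in> box_functions) \<Longrightarrow> alt_sum T n a \<in> box_functions"
  by (induction n arbitrary: a) (auto simp: additive_op_closed)

lemma alt_sum_0: "additive_op T \<Longrightarrow> alt_sum T n (\<lambda>i. 0) = 0"
  by (induction n) (auto simp: additive_op_0)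

lemma alt_sum_single: "additive_op T \<Longrightarrow> n > 0 \<Longrightarrow> alt_sum T n (\<lambda>i. if i = 0 then f else 0) = f"
  by (cases n) (auto simp: alt_sum_0 additive_op_0)

lemma alt_sum_add:
  "additive_op T \<Longrightarrow> (\<And>i. a i \<in> box_functions) \<Longrightarrow> (\<And>i. b i \<in> box_functions) \<Longrightarrow>
    alt_sum T n (\<lambda>i. a i + b i) = alt_sum T n a + alt_sum T n b"
  by (induction n arbitrary: a b) (auto simp: additive_op_add alt_sum_closed)

lemma alt_sum_image:
  assumes T: "additive_op T" and L: "additive_op L"
    and LT: "\<And>f. f \<in> box_functions \<Longrightarrow> L (T f) = T' (L f)"
  shows "(\<And>i. a i \<in> box_functions) \<Longrightarrow> L (alt_sum T n a) = alt_sum T' n (\<lambda>i. L (a i))"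
proof (induction n arbitrary: a)
  case (Suc n)
  then show ?case
    by (simp add: additive_op_diff[OF L] LT alt_sum_closed[OF T] additive_op_closed[OF T])
qed (simp add: additive_op_0[OF L])

lemma alt_sum_uminus:
  "additive_op T \<Longrightarrow> (\<And>i. a i \<in> box_functions) \<Longrightarrow> alt_sum T n (\<lambda>i. - a i) = - alt_sum T n a"
  using alt_sum_image[of T uminus T a n] additive_op_uminus[of T] by (simp add: additive_op_def)

lemma alt_sum_diff:
  assumes "additive_op T" "\<And>i. a i \<in> box_functions" "\<And>i. b i \<in> box_functions"
  shows "alt_sum T n (\<lambda>i. a i - b i) = alt_sum T n a - alt_sum T n b"
  using alt_sum_add[of T a "\<lambda>i. - b i" n] alt_sum_uminus[of T b n] assms by simp

lemma alt_sum_swap: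
  assumes T: "additive_op T" and U: "additive_op U"
    and TU: "\<And>f. f \<in> box_functions \<Longrightarrow> T (U f) = U (T f)"
  shows "(\<And>i j. a i j \<in> box_functions) \<Longrightarrow>
    alt_sum T n (\<lambda>i. alt_sum U m (\<lambda>j. a i j)) = alt_sum U m (\<lambda>j. alt_sum T n (\<lambda>i. a i j))"
proof (induction n arbitrary: a)
  case 0
  then show ?case by (simp add: alt_sum_0[OF U])
next
  case (Suc n)
  let ?b = "\<lambda>j. alt_sum T n (\<lambda>i. a (Suc i) j)"
  have b: "?b j \<in> box_functions" "T (?b j) \<in> box_functions" for j
    using Suc.prems by (auto simp: alt_sum_closed[OF T] additive_op_closed[OF T])
  have "alt_sum T (Suc n) (\<lambda>i. alt_sum U m (\<lambda>j. a i j)) = alt_sum U m (a 0) - T (alt_sum U m ?b)"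
    using Suc.IH[of "\<lambda>i. a (Suc i)"] Suc.prems by simp
  also have "T (alt_sum U m ?b) = alt_sum U m (\<lambda>j. T (?b j))"
    using alt_sum_image[of U T U ?b m] U T TU b(1) by simp
  also have "alt_sum U m (a 0) - \<dots> = alt_sum U m (\<lambda>j. a 0 j - T (?b j))"
    using Suc.prems b by (simp add: alt_sum_diff[OF U])
  finally show ?case by simp
qed

lemma alt_sum_eq_sum:
  assumes T: "additive_op T"
  shows "(\<And>i. a i \<in> box_functions) \<Longrightarrow> alt_sum T n a = (\<Sum>i<n. ((\<lambda>f. - T f) ^^ i) (a i))"
proof (induction n arbitrary: a)
  case (Suc n)
  have sum: "T (\<Sum>i\<in>I. g i) = (\<Sum>i\<in>I. T (g i))" if "\<And>i. g i \<in> box_functions" for g :: "nat \<Rightarrow> jet \<Rightarrow> real" and I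
    using that by (induction I rule: infinite_finite_induct) (auto simp: additive_op_0[OF T] additive_op_add[OF T])
  have closed: "((\<lambda>f. - T f) ^^ i) f \<in> box_functions" if "f \<in> box_functions" for i f
    using that by (induction i) (auto simp: additive_op_closed[OF T])
  show ?case
    unfolding sum.lessThan_Suc_shift
    using Suc by (simp add: sum closed sum_negf)
qed simp

end

section \<open>Total derivatives and their restrictions\<close>

text \<open>
  A Boolean selects the direction, true for \<open>\<xi>\<close> and false for \<open>\<eta>\<close>, so that statements that are mirror
  images of each other are proved once.
\<close>

definition indep :: "bool \<Rightarrow> coord"
  where "indep b = (if b then Xi else Eta)"

definition axis_var :: "bool \<Rightarrow> nat \<Rightarrow> coord"
  where "axis_var b k = (if b then W k 0 else W 0 k)"

text \<open>
  In direction \<open>\<xi>\<close> these are \<open>\<xi>, w, w\<^sub>k\<^sub>0\<close>.  The two lines meet only in \<open>w\<close>, and that variable is what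
  couples the two directions on the solution set.
\<close>

definition line :: "bool \<Rightarrow> coord set"
  where "line b = insert (indep b) (range (axis_var b))"

definition mixed :: "coord set"
  where "mixed = {W k l |k l. 1 \<le> k \<and> 1 \<le> l}"

fun nxt :: "bool \<Rightarrow> coord \<Rightarrow> coord" where
  "nxt b (W k l) = (if b then W (Suc k) l else W k (Suc l))"
| "nxt b c = c"

lemma axis_0 [simp]: "axis_var b 0 = W 0 0"
  by (simp add: axis_var_def)

lemma axis_eq_w [simp]: "axis_var b k = W 0 0 \<longleftrightarrow> k = 0" "W 0 0 = axis_var b k \<longleftrightarrow> k = 0"
  by (auto simp: axis_var_def)

lemma axis_inject [simp]: "axis_var b k = axis_var b l \<longleftrightarrow> k = l"
  by (auto simp: axis_var_def)

lemma axis_neq_indep [simp]: "axis_var b k \<noteq> indep d" "indep d \<noteq> axis_var b k"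
  by (auto simp: axis_var_def indep_def)

lemma indep_neq_W [simp]: "indep b \<noteq> W k l" "W k l \<noteq> indep b"
  by (auto simp: indep_def)

lemma indep_inject [simp]: "indep b = indep d \<longleftrightarrow> b = d"
  by (auto simp: indep_def)

lemma nxt_axis [simp]: "nxt b (axis_var b k) = axis_var b (Suc k)"
  by (simp add: axis_var_def)

lemma nxt_inject [simp]: "nxt b c = nxt b d \<longleftrightarrow> c = d"
  by (cases c; cases d) auto

lemma axis_in_line [simp]: "axis_var b k \<in> line b" "W 0 0 \<in> line b" "indep b \<in> line b"
  by (auto simp: line_def image_iff intro: exI[of _ 0])

lemma coord_cases: "c \<in> line True \<or> c \<in> line False \<or> c \<in> mixed"
proof (cases c)
  case (W k l)
  then show ?thesis
    by (cases k; cases l) (auto simp: line_def mixed_def axis_var_def image_def)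
qed (auto simp: line_def indep_def)

lemma line_Int: "c \<in> line b \<Longrightarrow> c \<in> line (\<not> b) \<Longrightarrow> c = W 0 0"
  by (auto simp: line_def axis_var_def indep_def split: if_splits)

lemma line_mixed: "c \<in> line b \<Longrightarrow> c \<notin> mixed"
  by (auto simp: line_def axis_var_def indep_def mixed_def split: if_splits)

lemma nxt_in_line: "c \<in> line b \<Longrightarrow> nxt b c \<in> line b - {W 0 0}"
  by (auto simp: line_def axis_var_def indep_def split: if_splits)

lemma nxt_mixed: "c \<notin> line b \<Longrightarrow> c = W k l \<Longrightarrow> nxt b c \<in> mixed"
  by (cases k; cases l) (auto simp: line_def axis_var_def indep_def mixed_def image_def split: if_splits)

context jet_box
begin

definition total_field :: "bool \<Rightarrow> coord \<Rightarrow> jet \<Rightarrow> real"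
  where "total_field b c = (case c of W k l \<Rightarrow> jet_var (nxt b c) | _ \<Rightarrow> if c = indep b then const 1 else 0)"

text \<open>
  The total derivative with only the terms for variables in \<open>S\<close>.  For \<open>S = UNIV\<close> this is the total
  derivative itself, for \<open>S = line b\<close> its restriction to the solution set, and for
  \<open>S = line b - {W 0 0}\<close> the reduced operator that occurs in the distinguished form.
\<close>

definition D :: "bool \<Rightarrow> coord set \<Rightarrow> (jet \<Rightarrow> real) \<Rightarrow> jet \<Rightarrow> real"
  where "D b S = vfield (\<lambda>c. if c \<in> S then total_field b c else 0)"

lemma total_field_W [simp]: "total_field b (W k l) = jet_var (nxt b (W k l))"
  and total_field_indep: "total_field b (indep d) = (if b = d then const 1 else 0)"
  and total_field_axis [simp]: "total_field b (axis_var d k) = jet_var (nxt b (axis_var d k))"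
  by (auto simp: total_field_def axis_var_def indep_def)

lemma total_field_closed [simp, intro]: "total_field b c \<in> box_functions"
  by (auto simp: total_field_def split: coord.split)

lemma D_closed [simp, intro]: "f \<in> box_functions \<Longrightarrow> D b S f \<in> box_functions"
  by (auto simp: D_def)

lemma additive_D [simp, intro]: "additive_op (D b S)"
  by (auto simp: D_def intro: additive_vfield)

lemma D_0 [simp]: "D b S 0 = 0"
  by (simp add: D_def)

lemma part_total_field: "part d (total_field b c) = (if (\<exists>k l. c = W k l) \<and> d = nxt b c then const 1 else 0)"
  by (cases c) (auto simp: total_field_def part_jet_var)

lemma vfield_single: "f \<in> box_functions \<Longrightarrow> vfield (\<lambda>c. if c = c0 then g else 0) f = g * part c0 f"
  by (subst vfield_eq[of "insert c0 {c. part c f \<noteq> 0}"])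
    (auto simp: finite_support sum.remove[of _ c0] intro!: sum.neutral)

lemma part_D:
  assumes "f \<in> box_functions"
  shows "part d (D b S f) = D b S (part d f) +
    vfield (\<lambda>c. if c \<in> S \<and> (\<exists>k l. c = W k l) \<and> d = nxt b c then const 1 else 0) f"
  unfolding D_def
  by (subst part_vfield) (use assms in \<open>auto simp: part_total_field if_distrib[of "part _"] cong: if_cong
    intro!: arg_cong[where f = "\<lambda>v. vfield v f"]\<close>)

lemma part_D_shift:
  assumes f: "f \<in> box_functions" and "W k l \<in> S" "d = nxt b (W k l)"
  shows "part d (D b S f) = D b S (part d f) + part (W k l) f"
proof -
  have "(\<lambda>c. if c \<in> S \<and> (\<exists>k l. c = W k l) \<and> d = nxt b c then const 1 else 0) =
      (\<lambda>c. if c = W k l then const 1 else 0)"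
    using assms by (auto simp del: nxt.simps)
  then show ?thesis by (simp only: part_D[OF f] vfield_single[OF f]) (simp add: f)
qed

lemma part_D_axis:
  assumes "f \<in> box_functions" "axis_var b k \<in> S"
  shows "part (axis_var b (Suc k)) (D b S f) = D b S (part (axis_var b (Suc k)) f) + part (axis_var b k) f"
proof -
  obtain i j where "axis_var b k = W i j" by (cases b) (auto simp: axis_var_def)
  then show ?thesis using part_D_shift[of f i j S "axis_var b (Suc k)" b] assms nxt_axis[of b k] by simp
qed

lemma part_D_commute:
  assumes f: "f \<in> box_functions" and "\<And>c. c \<in> S \<Longrightarrow> (\<exists>k l. c = W k l) \<Longrightarrow> nxt b c \<noteq> d"
  shows "part d (D b S f) = D b S (part d f)"
proof -
  have "(\<lambda>c. if c \<in> S \<and> (\<exists>k l. c = W k l) \<and> d = nxt b c then const 1 else 0) = (\<lambda>c. 0)"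
    using assms(2) by (auto simp: fun_eq_iff)
  then show ?thesis by (simp only: part_D[OF f]) (simp add: vfield_def)
qed

lemma part_D_line_commute:
  assumes "f \<in> box_functions" "S \<subseteq> line b" "c \<notin> line b - {W 0 0, indep b}"
  shows "part c (D b S f) = D b S (part c f)"
proof (rule part_D_commute[OF assms(1)])
  fix d assume d: "d \<in> S" "\<exists>k l. d = W k l"
  then have "nxt b d \<in> line b - {W 0 0}" using assms(2) by (intro nxt_in_line) auto
  moreover have "nxt b d \<noteq> indep b" using d by (cases b) auto
  ultimately show "nxt b d \<noteq> c" using assms(3) by auto
qed

lemma freeze_D:
  assumes f: "f \<in> box_functions" and "A \<inter> S = {}" "\<And>c. c \<in> S \<Longrightarrow> nxt b c \<notin> A"
  shows "freeze A (D b S f) = D b S (freeze A f)"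
  unfolding D_def
  by (rule freeze_vfield[OF f]) (use assms in \<open>auto simp: total_field_def freeze_jet_var split: coord.split simp del: nxt.simps\<close>)

text \<open>
  The coefficients of either operator are constants or variables that the other operator annihilates.
\<close>

lemma D_line_commute:
  assumes "f \<in> box_functions"
  shows "D b (line b) (D (\<not> b) (line (\<not> b)) f) = D (\<not> b) (line (\<not> b)) (D b (line b) f)"
proof -
  have *: "vfield (\<lambda>c. if c \<in> line b then total_field b c else 0) (if c \<in> line (\<not> b) then total_field (\<not> b) c else 0) = 0" for b c
  proof (cases "\<exists>k l. c = W k l \<and> c \<in> line (\<not> b)")
    case True
    then have "nxt (\<not> b) c \<notin> line b" using nxt_in_line[of c "\<not> b"] line_Int[of _ b] by auto
    then show ?thesis using True by (auto simp: vfield_jet_var simp del: nxt.simps)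
  qed (auto simp: total_field_def split: coord.split)
  show ?thesis
    unfolding D_def
    by (rule vfield_commute) (use assms *[of b] *[of "\<not> b", unfolded not_not] in auto)
qed

lemma D_line_eq:
  assumes "f \<in> box_functions"
  shows "D b (line b) f = D b (line b - {W 0 0}) f + jet_var (axis_var b 1) * part (W 0 0) f"
proof -
  have "(\<lambda>c. if c \<in> line b then total_field b c else 0) =
      (\<lambda>c. (if c \<in> line b - {W 0 0} then total_field b c else 0) + (if c = W 0 0 then jet_var (axis_var b 1) else 0))"
    by (auto simp: fun_eq_iff[of "\<lambda>c. if c \<in> line b then total_field b c else 0"] axis_var_def)
  then show ?thesis unfolding D_def using assms by (simp only: vfield_add_field vfield_single)
qed

text \<open>
  If \<open>K\<close> had highest order \<open>k\<close> in direction \<open>b\<close>, then \<open>D K\<close> would have order \<open>k + 1\<close>; descending from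
  high orders, all derivatives along the line vanish, and then \<open>D K\<close> is the remaining derivative with
  respect to the independent variable.
\<close>

lemma part_eq_0_if_D_line_eq_0:
  assumes K: "K \<in> box_functions" "D b (line b) K = 0" and c: "c \<in> line b"
  shows "part c K = 0"
proof -
  have "finite (axis_var b -` {c. part c K \<noteq> 0})"
    by (rule finite_vimageI[OF finite_support[OF K(1)]]) (auto simp: inj_def)
  then obtain n where n: "\<And>k. k \<ge> n \<Longrightarrow> part (axis_var b k) K = 0"
    by (auto simp: finite_nat_set_iff_bounded_le) (metis not_less_eq_eq)
  have down: "part (axis_var b k) K = 0" if "part (axis_var b (Suc k)) K = 0" for k
    using part_D_axis[OF K(1), of b k "line b"] K(2) that by simp
  have axis_var: "part (axis_var b k) K = 0" for k
  proof (cases "k \<le> n")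
    case True
    then show ?thesis using n[of n] by (induction rule: inc_induct) (auto intro: down)
  qed (use n in auto)
  have "D b (line b) K = vfield (\<lambda>c. if c = indep b then const 1 else 0) K"
    unfolding D_def by (rule vfield_cong) (auto simp: line_def axis_var total_field_indep)
  then have "part (indep b) K = 0" using K by (simp add: vfield_single)
  then show ?thesis using axis_var c by (auto simp: line_def)
qed


section \<open>Characteristics on the solution set\<close>

text \<open>
  The operator \<open>E\<close> of the introduction, with the operator \<open>D b S\<close> and truncated to \<open>n\<close> terms.
\<close>

definition euler :: "bool \<Rightarrow> coord set \<Rightarrow> nat \<Rightarrow> (jet \<Rightarrow> real) \<Rightarrow> jet \<Rightarrow> real"
  where "euler b S n f = alt_sum (D b S) n (\<lambda>l. part (axis_var b (Suc l)) f)"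

lemma euler_closed [simp, intro]: "f \<in> box_functions \<Longrightarrow> euler b S n f \<in> box_functions"
  unfolding euler_def by (rule alt_sum_closed) auto

lemma euler_add:
  "f \<in> box_functions \<Longrightarrow> g \<in> box_functions \<Longrightarrow> euler b S n (f + g) = euler b S n f + euler b S n g"
  unfolding euler_def by (simp add: part_add alt_sum_add)

lemma euler_uminus: "f \<in> box_functions \<Longrightarrow> euler b S n (- f) = - euler b S n f"
  unfolding euler_def by (simp add: part_uminus alt_sum_uminus)

text \<open>
  The identity \<open>E D = \<partial>/\<partial>w\<close>.  It replaces the integration of the conservation law.
\<close>

lemma euler_D_line:
  assumes "f \<in> box_functions" "part (axis_var b n) f = 0"
  shows "euler b (line b) n (D b (line b) f) = part (W 0 0) f"
  using alt_sum_telescope[of "\<lambda>l. part (axis_var b l) f" n "D b (line b)"] assms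
  by (simp add: euler_def part_D_axis)

lemma part_euler_line:
  assumes "f \<in> box_functions" "c \<notin> line b - {W 0 0, indep b}"
  shows "part c (euler b (line b) n f) = euler b (line b) n (part c f)"
  unfolding euler_def
  using assms
  by (subst alt_sum_image[OF additive_D additive_part, where T' = "D b (line b)"])
    (auto simp: part_D_line_commute part_commute[of f c])

lemma D_euler_line:
  assumes "f \<in> box_functions"
  shows "D (\<not> b) (line (\<not> b)) (euler b (line b) n f) = euler b (line b) n (D (\<not> b) (line (\<not> b)) f)"
proof -
  have "axis_var b (Suc l) \<notin> line (\<not> b) - {W 0 0, indep (\<not> b)}" for l
    using line_Int[of "axis_var b (Suc l)" b] by auto
  then show ?thesis
    unfolding euler_def
    using assms D_line_commute[of _ b]
    by (subst alt_sum_image[OF additive_D additive_D, where T' = "D b (line b)"])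
      (auto simp: part_D_line_commute)
qed

text \<open>
  This fails for the unreduced operator, whose coefficient at \<open>w\<close> survives the freezing of \<open>w\<close>.
\<close>

lemma freeze_D_reduced:
  assumes "f \<in> box_functions"
  shows "freeze (line (\<not> b)) (D b (line b - {W 0 0}) f) =
    D b (line b - {W 0 0}) (freeze (line (\<not> b)) f)"
proof (rule freeze_D[OF assms])
  show "line (\<not> b) \<inter> (line b - {W 0 0}) = {}" using line_Int by blast
  show "nxt b c \<notin> line (\<not> b)" if "c \<in> line b - {W 0 0}" for c
    using line_Int[of "nxt b c" b] nxt_in_line[of c b] that by auto
qed

lemma freeze_euler_reduced:
  assumes "f \<in> box_functions"
  shows "freeze (line (\<not> b)) (euler b (line b - {W 0 0}) n f) =
    euler b (line b - {W 0 0}) n (freeze (line (\<not> b)) f)"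
proof -
  have "axis_var b (Suc l) \<notin> line (\<not> b)" for l
    using line_Int[of "axis_var b (Suc l)" b] by auto
  then show ?thesis
    unfolding euler_def
    using assms freeze_D_reduced[of _ b]
    by (subst alt_sum_image[OF additive_D additive_freeze, where T' = "D b (line b - {W 0 0})"])
      (auto simp: part_freeze)
qed

text \<open>
  The total derivatives are tangent to the solution set.
\<close>

lemma freeze_mixed_D:
  assumes "p \<in> solution_set" "f \<in> box_functions"
  shows "freeze mixed (D b UNIV f) = D b (line b) (freeze mixed f)"
proof -
  have p0: "p c = 0" if "c \<in> mixed" for c
    using assms(1) that by (auto simp: mixed_def solution_set_def)
  show ?thesis unfolding D_def
  proof (rule freeze_vfield[OF assms(2)])
    fix c assume "c \<in> mixed"
    then obtain k l where "c = W k l" "nxt b c \<in> mixed" by (auto simp: mixed_def)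
    then show "freeze mixed (if c \<in> UNIV then total_field b c else 0) = 0"
      using p0 by (auto simp: freeze_jet_var zero_eq_const simp del: nxt.simps)
  next
    fix c assume c: "c \<notin> mixed"
    show "freeze mixed (if c \<in> UNIV then total_field b c else 0) = (if c \<in> line b then total_field b c else 0)"
    proof (cases "\<exists>k l. c = W k l")
      case True
      then obtain k l where W: "c = W k l" by blast
      show ?thesis
      proof (cases "c \<in> line b")
        case True
        then show ?thesis using nxt_in_line[OF True] line_mixed[of "nxt b c" b] W
          by (auto simp: freeze_jet_var simp del: nxt.simps)
      next
        case False
        then show ?thesis using nxt_mixed[OF False W] p0 W
          by (auto simp: freeze_jet_var zero_eq_const simp del: nxt.simps)
      qed
    next
      case False
      then have "c = indep True \<or> c = indep False" by (cases c) (auto simp: indep_def)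
      then show ?thesis by (auto simp: total_field_indep line_def)
    qed
  qed
qed

text \<open>
  The linear part of the conservation law in the directions transversal to the solution set, summed with
  alternating signs.  The bound \<open>n\<close> exceeds all orders that occur in the current, so both telescoping sums
  end with a vanishing term.
\<close>

lemma characteristic_on_solutions:
  assumes p: "p \<in> solution_set" and \<mu>: "\<mu> \<in> box_functions" and J: "\<And>b. J b \<in> box_functions"
    and eq: "\<mu> * jet_var (W 1 1) = D True UNIV (J True) + D False UNIV (J False)"
    and n: "0 < n" "\<And>b k l. n \<le> k \<or> n \<le> l \<Longrightarrow> part (W k l) (J b) = 0"
  shows "freeze mixed \<mu> = euler False (line False) n (freeze mixed (J True)) +
      euler True (line True) n (freeze mixed (J False))"
    and "D True (line True) (freeze mixed (J True)) + D False (line False) (freeze mixed (J False)) = 0"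
proof -
  define a where "a = (\<lambda>b k l. freeze mixed (part (W k l) (J b)))"
  have a_closed: "a b k l \<in> box_functions" for b k l using J by (auto simp: a_def)
  have a_part: "a b k l = part (W k l) (freeze mixed (J b))" if "k = 0 \<or> l = 0" for b k l
    using that J[of b] by (auto simp: a_def part_freeze mixed_def)
  let ?U = "D True (line True)" and ?V = "D False (line False)"
  \<comment> \<open>The two brackets of the linearized identity, with the indices \<open>k\<close> and \<open>l\<close> starting from \<open>0\<close>.\<close>
  define A where "A = (\<lambda>k l. ?U (a True (Suc k) (Suc l)) + a True k (Suc l))"
  define C where "C = (\<lambda>k l. ?V (a False (Suc k) (Suc l)) + a False (Suc k) l)"
  have closed: "A k l \<in> box_functions" "C k l \<in> box_functions" for k l
    by (auto simp: A_def C_def a_closed)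
  have X11: "freeze mixed (jet_var (W 1 1)) = 0"
    using p by (auto simp: freeze_jet_var mixed_def solution_set_def zero_eq_const)
  have M: "(if k = 0 \<and> l = 0 then freeze mixed \<mu> else 0) = A k l + C k l" for k l
  proof -
    let ?d = "part (W (Suc k) (Suc l))"
    have "(if k = 0 \<and> l = 0 then freeze mixed \<mu> else 0) = freeze mixed (?d (\<mu> * jet_var (W 1 1)))"
      using \<mu> X11 by (auto simp: part_mult freeze_add freeze_mult part_jet_var)
    also have "\<dots> = freeze mixed (?d (D True UNIV (J True))) + freeze mixed (?d (D False UNIV (J False)))"
      unfolding eq using J by (simp add: part_add freeze_add)
    also have "?d (D True UNIV (J True)) = D True UNIV (?d (J True)) + part (W k (Suc l)) (J True)"
      using J by (intro part_D_shift) auto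
    also have "?d (D False UNIV (J False)) = D False UNIV (?d (J False)) + part (W (Suc k) l) (J False)"
      using J by (intro part_D_shift) auto
    finally show ?thesis
      using J by (simp add: freeze_add freeze_mixed_D[OF p] A_def C_def a_def)
  qed
  have "freeze mixed \<mu> = alt_sum ?U n (\<lambda>k. alt_sum ?V n (\<lambda>l. if k = 0 \<and> l = 0 then freeze mixed \<mu> else 0))"
  proof -
    have "alt_sum ?V n (\<lambda>l. if k = 0 \<and> l = 0 then freeze mixed \<mu> else 0) =
        (if k = 0 then freeze mixed \<mu> else 0)" for k :: nat
      using n(1) by (cases "k = 0") (auto simp: alt_sum_single alt_sum_0)
    then show ?thesis using n(1) by (simp add: alt_sum_single)
  qed
  also have "\<dots> = alt_sum ?U n (\<lambda>k. alt_sum ?V n (A k)) + alt_sum ?U n (\<lambda>k. alt_sum ?V n (C k))"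
    unfolding M using closed by (simp add: alt_sum_add alt_sum_closed)
  also have "alt_sum ?U n (\<lambda>k. alt_sum ?V n (A k)) = alt_sum ?V n (\<lambda>l. alt_sum ?U n (\<lambda>k. A k l))"
    using D_line_commute[of _ True] closed by (intro alt_sum_swap) auto
  also have "(\<lambda>l. alt_sum ?U n (\<lambda>k. A k l)) = (\<lambda>l. a True 0 (Suc l))"
    unfolding A_def using alt_sum_telescope[of "\<lambda>k. a True k (Suc _)" n ?U] n(2) by (simp add: a_def)
  also have "(\<lambda>k. alt_sum ?V n (C k)) = (\<lambda>k. a False (Suc k) 0)"
    unfolding C_def using alt_sum_telescope[of "\<lambda>l. a False (Suc _) l" n ?V] n(2) by (simp add: a_def)
  finally show "freeze mixed \<mu> = euler False (line False) n (freeze mixed (J True)) +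
      euler True (line True) n (freeze mixed (J False))"
    by (simp add: euler_def axis_var_def a_part)
  have "freeze mixed (D True UNIV (J True) + D False UNIV (J False)) = 0"
    unfolding eq[symmetric] using X11 by (simp add: freeze_mult)
  then show "?U (freeze mixed (J True)) + ?V (freeze mixed (J False)) = 0"
    using J by (simp add: freeze_add freeze_mixed_D[OF p])
qed

text \<open>
  Let \<open>w\<^sub>j\<close> be the derivative of order \<open>j\<close> in direction \<open>b\<close>, and \<open>S\<^sub>j\<close> the tail of the Euler sum that
  starts with \<open>\<partial>/\<partial>w\<^sub>j\<close>.  Then the hypothesis on \<open>K\<close> telescopes to
  \<open>\<partial>S\<^sub>j\<^sub>+\<^sub>1/\<partial>w = -\<partial>K/\<partial>w\<^sub>j\<close>.  Hence the part \<open>w\<^sub>1 \<partial>/\<partial>w\<close> of \<open>D\<close> contributes exactly the terms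
  \<open>w\<^sub>1 \<partial>K/\<partial>w\<^sub>j\<close>, which can be absorbed into the argument of the reduced sum.
\<close>

lemma euler_line_eq_reduced:
  assumes f: "f \<in> box_functions" and K: "K \<in> box_functions"
    and DK: "D b (line b) K = - part (W 0 0) f"
    and n: "0 < n" "part (axis_var b n) K = 0"
  shows "euler b (line b) n f + K = euler b (line b - {W 0 0}) n (f + jet_var (axis_var b 1) * K)"
proof -
  let ?T = "D b (line b)" and ?R = "D b (line b - {W 0 0})"
  let ?f = "\<lambda>i. part (axis_var b i) f" and ?K = "\<lambda>i. part (axis_var b i) K"
  have w: "part (W 0 0) (alt_sum ?T m (\<lambda>i. ?f (Suc (j + i)))) = - ?K j"
    if "?K (j + m) = 0" for j m
  proof -
    have "part (W 0 0) (alt_sum ?T m (\<lambda>i. ?f (Suc (j + i)))) =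
        alt_sum ?T m (\<lambda>i. part (W 0 0) (?f (Suc (j + i))))"
      using f by (intro alt_sum_image additive_D additive_part) (auto simp: part_D_line_commute)
    also have "\<dots> = alt_sum ?T m (\<lambda>i. - (?T (?K (j + Suc i)) + ?K (j + i)))"
      using f K DK by (intro alt_sum_cong) (simp add: part_commute[of f "W 0 0"] eq_neg_iff_add_eq_0[symmetric]
          part_uminus[symmetric] part_D_axis[symmetric] minus_equation_iff[of "part (W 0 0) f"])
    also have "\<dots> = - ?K j"
      using K alt_sum_telescope[of "\<lambda>i. ?K (j + i)" m ?T] that
        alt_sum_uminus[of ?T "\<lambda>i. ?T (?K (j + Suc i)) + ?K (j + i)" m] by simp
    finally show ?thesis .
  qed
  have main: "alt_sum ?T m (\<lambda>i. ?f (j + i)) = alt_sum ?R m (\<lambda>i. ?f (j + i) + jet_var (axis_var b 1) * ?K (j + i))"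
    if "0 < m \<longrightarrow> ?K (j + m - 1) = 0" for j m
    using that
  proof (induction m arbitrary: j)
    case (Suc m)
    let ?S = "alt_sum ?T m (\<lambda>i. ?f (Suc (j + i)))"
    have S: "?S \<in> box_functions" using f by (auto intro: alt_sum_closed)
    have "alt_sum ?R m (\<lambda>i. ?f (Suc (j + i)) + jet_var (axis_var b 1) * ?K (Suc (j + i))) = ?S"
      using Suc.IH[of "Suc j"] Suc.prems by simp
    moreover have "part (W 0 0) ?S = - ?K j" using w Suc.prems by simp
    ultimately show ?case using D_line_eq[OF S, of b] by simp
  qed simp
  have "part (axis_var b (Suc i)) (f + jet_var (axis_var b 1) * K) =
      (?f (Suc i) + jet_var (axis_var b 1) * ?K (Suc i)) + (if i = 0 then K else 0)" for i
    using f K by (auto simp: part_add part_mult part_jet_var)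
  then have "euler b (line b - {W 0 0}) n (f + jet_var (axis_var b 1) * K) =
      alt_sum ?R n (\<lambda>i. ?f (Suc i) + jet_var (axis_var b 1) * ?K (Suc i)) + K"
    using f K n by (simp add: euler_def alt_sum_add alt_sum_single)
  then show ?thesis using main[of n 1] n by (simp add: euler_def)
qed

text \<open>
  The difference of \<open>f\<close> and its frozen version no longer depends on the variables of the other line, so
  freezing these does not change it.
\<close>

lemma split_by_freezing:
  assumes f: "f \<in> box_functions" and w: "part (W 0 0) f = 0"
    and mix: "\<And>c. c \<in> mixed \<Longrightarrow> part c f = 0"
    and cross: "\<And>c d. c \<in> line True \<Longrightarrow> d \<in> line False \<Longrightarrow> part c (part d f) = 0"
  shows "f = freeze (line False) f + freeze (line True) f - const (f p)"
proof -
  let ?g = "f - freeze (line True) f"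
  have "freeze (line False) ?g = ?g"
  proof (rule freeze_id)
    fix c assume c: "c \<in> line False"
    show "part c ?g = 0"
    proof (cases "c \<in> line True")
      case True
      then have "c = W 0 0" using line_Int[of c True] c by simp
      then show ?thesis using f w by (simp add: part_diff part_freeze)
    next
      case False
      then show ?thesis using f cross[OF _ c] by (simp add: part_diff part_freeze freeze_id)
    qed
  qed (use f in auto)
  moreover have "freeze (line False \<union> line True) f = const (f p)"
  proof -
    have "freeze (line False \<union> line True) (freeze mixed f) = const (f p)"
    proof -
      have "line False \<union> line True \<union> mixed = UNIV" using coord_cases by auto
      moreover have "frozen UNIV x = p" for x by (auto simp: frozen_def)
      ultimately show ?thesis by (simp add: freeze_freeze) (simp add: freeze_def const_def)
    qed
    then show ?thesis using freeze_id[OF f mix] by simp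
  qed
  ultimately show ?thesis by (simp add: freeze_diff freeze_freeze algebra_simps)
qed

text \<open>
  \<open>R b\<close> is the component of the conserved current to which the Euler sum of direction \<open>b\<close> applies.
  Freezing, first of the Euler sums and then of the corrected currents, takes the place of a potential for
  the conservation law.
\<close>

theorem on_shell_characteristic_form:
  assumes R: "\<And>b. R b \<in> box_functions"
    and mix: "\<And>b c. c \<in> mixed \<Longrightarrow> part c (R b) = 0"
    and cons: "\<And>b. D (\<not> b) (line (\<not> b)) (R b) = - D b (line b) (R (\<not> b))"
    and n: "2 \<le> n" "\<And>b d k. n \<le> k \<Longrightarrow> part (axis_var d k) (R b) = 0"
  shows "\<exists>F. (\<forall>b. F b \<in> box_functions \<and>
        (\<forall>c. c \<notin> insert (indep b) {axis_var b k |k. 1 \<le> k \<and> k \<le> n} \<longrightarrow> part c (F b) = 0)) \<and>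
      euler True (line True) n (R True) + euler False (line False) n (R False) =
        euler True (line True - {W 0 0}) n (F True) + euler False (line False - {W 0 0}) n (F False)"
proof -
  let ?T = "\<lambda>b. D b (line b)" and ?E = "\<lambda>b. euler b (line b) n (R b)"
  define \<mu> where "\<mu> = ?E True + ?E False"
  have \<mu>_b: "\<mu> = ?E b + ?E (\<not> b)" for b by (cases b) (auto simp: \<mu>_def add.commute)
  have \<mu>: "\<mu> \<in> box_functions" using R by (simp add: \<mu>_def)
  have E_top: "part (axis_var b k) (?E (\<not> b)) = 0" if "n \<le> k" for b k
  proof -
    have "axis_var b k \<notin> line (\<not> b) - {W 0 0, indep (\<not> b)}"
      using line_Int[of "axis_var b k" b] by auto
    then show ?thesis using R n(2)[OF that] by (simp add: part_euler_line) (simp add: euler_def alt_sum_0)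
  qed
  have E_mix: "part c (?E b) = 0" if "c \<in> mixed" for b c
  proof -
    have "c \<notin> line b" using line_mixed that by blast
    then show ?thesis using R mix[OF that] by (simp add: part_euler_line) (simp add: euler_def alt_sum_0)
  qed
  have DE: "?T (\<not> b) (?E b) = - part (W 0 0) (R (\<not> b))" for b
  proof -
    have "?T (\<not> b) (?E b) = euler b (line b) n (- ?T b (R (\<not> b)))"
      using R by (simp add: D_euler_line cons)
    also have "\<dots> = - part (W 0 0) (R (\<not> b))"
      using R n by (simp add: euler_uminus euler_D_line)
    finally show ?thesis .
  qed
  \<comment> \<open>The derivative of \<open>\<mu>\<close> with respect to \<open>w\<close> is equal to its own negative.\<close>
  have w_E: "part (W 0 0) (?E b) = - part (W 0 0) (?E (\<not> b))" for b
  proof -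
    have "part (W 0 0) (?E b) = euler b (line b) n (part (W 0 0) (R b))"
      using R by (simp add: part_euler_line)
    also have "part (W 0 0) (R b) = - ?T b (?E (\<not> b))" using DE[of "\<not> b"] by simp
    also have "euler b (line b) n \<dots> = - part (W 0 0) (?E (\<not> b))"
      using R E_top by (simp add: euler_uminus euler_D_line)
    finally show ?thesis .
  qed
  have w: "part (W 0 0) \<mu> = 0"
    using R w_E[of True] by (simp add: \<mu>_def part_add)
  have TT: "?T True (?T False \<mu>) = 0"
  proof -
    have D_w: "?T b (part (W 0 0) f) = part (W 0 0) (?T b f)" if "f \<in> box_functions" for b f
      using that by (simp add: part_D_line_commute)
    have "?T True (?T False (?E b)) = - part (W 0 0) (?T b (R (\<not> b)))" for b
      using R DE[of b] D_line_commute[of "?E b" b]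
      by (cases b) (simp_all add: D_w additive_op_uminus[OF additive_D])
    then show ?thesis
      using R cons[of True]
      by (simp add: \<mu>_def additive_op_add[OF additive_D] part_uminus)
  qed
  have cross: "part c (part d \<mu>) = 0" if c: "c \<in> line True" and d: "d \<in> line False" for c d
  proof -
    have "part c (?T False \<mu>) = 0"
      using part_eq_0_if_D_line_eq_0[OF _ TT c] \<mu> by simp
    moreover have "c \<notin> line False - {W 0 0, indep False}"
      using line_Int[of c True] c by auto
    ultimately have "?T False (part c \<mu>) = 0" using \<mu> by (simp add: part_D_line_commute)
    then show ?thesis
      using part_eq_0_if_D_line_eq_0[of "part c \<mu>" False d] \<mu> d by (simp add: part_commute[of \<mu> c])
  qed
  define G where "G = (\<lambda>b. freeze (line (\<not> b)) (R b + jet_var (axis_var b 1) * ?E (\<not> b)))"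
  have G: "freeze (line (\<not> b)) \<mu> = euler b (line b - {W 0 0}) n (G b)" for b
  proof -
    have "\<mu> = euler b (line b - {W 0 0}) n (R b + jet_var (axis_var b 1) * ?E (\<not> b))"
      unfolding \<mu>_b[of b] using R n E_top DE[of "\<not> b"]
      by (intro euler_line_eq_reduced) auto
    then show ?thesis using R by (simp add: G_def freeze_euler_reduced)
  qed
  have G_part: "part c (G b) = 0" if c: "c \<notin> insert (indep b) {axis_var b k |k. 1 \<le> k \<and> k \<le> n}" for b c
  proof (cases "c \<in> line (\<not> b)")
    case False
    have "c \<in> line b \<or> c \<in> mixed" using coord_cases[of c] False by (cases b) auto
    then have "part c (R b + jet_var (axis_var b 1) * ?E (\<not> b)) = 0"
    proof
      assume "c \<in> mixed"
      moreover from this have "c \<noteq> axis_var b 1" by (auto simp: mixed_def axis_var_def)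
      ultimately show ?thesis using R mix E_mix by (auto simp: part_add part_mult part_jet_var)
    next
      assume "c \<in> line b"
      then obtain k where k: "c = axis_var b k" using c by (auto simp: line_def)
      have "k \<noteq> 0" using False k by (intro notI) simp
      then have "n < k" using c k by auto
      note k = k \<open>k \<noteq> 0\<close> \<open>n < k\<close>
      then show ?thesis using R n E_top by (auto simp: part_add part_mult part_jet_var)
    qed
    then show ?thesis using R by (simp add: G_def part_freeze)
  qed (use R in \<open>simp add: G_def part_freeze\<close>)
  \<comment> \<open>Both frozen versions of \<open>\<mu>\<close> contain the constant \<open>\<mu> p\<close>; the surplus one is removed from the
    \<open>\<eta>\<close>-part.\<close>
  define F where "F = (\<lambda>b. if b then G b else G b - const (\<mu> p) * jet_var (axis_var b 1))"
  have G_closed: "G b \<in> box_functions" for b using R by (simp add: G_def)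
  have "euler False (line False - {W 0 0}) n (const (\<mu> p) * jet_var (axis_var False 1)) = const (\<mu> p)"
  proof -
    have "(\<lambda>l. part (axis_var False (Suc l)) (const (\<mu> p) * jet_var (axis_var False 1))) = (\<lambda>l. if l = 0 then const (\<mu> p) else 0)"
      by (auto simp: part_mult part_jet_var)
    then show ?thesis using n by (simp only: euler_def) (simp add: alt_sum_single)
  qed
  moreover have "\<mu> = freeze (line False) \<mu> + freeze (line True) \<mu> - const (\<mu> p)"
    using \<mu> w cross R E_mix by (intro split_by_freezing) (auto simp: \<mu>_def part_add)
  moreover have "euler False (line False - {W 0 0}) n (G False - const (\<mu> p) * jet_var (axis_var False 1)) =
      euler False (line False - {W 0 0}) n (G False)
      - euler False (line False - {W 0 0}) n (const (\<mu> p) * jet_var (axis_var False 1))"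
    using G_closed euler_add[of "G False" "- (const (\<mu> p) * jet_var (axis_var False 1))"]
      euler_uminus[of "const (\<mu> p) * jet_var (axis_var False 1)"] by simp
  ultimately have "\<mu> = euler True (line True - {W 0 0}) n (F True) + euler False (line False - {W 0 0}) n (F False)"
    using G[of True] G[of False] by (simp add: F_def add_diff_eq)
  moreover have "part c (F b) = 0" if "c \<notin> insert (indep b) {axis_var b k |k. 1 \<le> k \<and> k \<le> n}" for b c
  proof -
    have "c \<noteq> axis_var b 1" using that n by auto
    then show ?thesis using G_part[OF that] G_closed by (auto simp: F_def part_diff part_mult part_jet_var)
  qed
  ultimately show ?thesis
    unfolding \<mu>_def by (intro exI[of _ F]) (auto simp: F_def G_closed)
qed


section \<open>Reduced Euler sums as characteristics\<close>

text \<open>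
  The variables on which \<open>F\<close> (or \<open>G\<close>) may depend.
\<close>

definition reduced_coords :: "bool \<Rightarrow> nat \<Rightarrow> coord set"
  where "reduced_coords b n = insert (indep b) {axis_var b k |k. 1 \<le> k \<and> k \<le> n}"

text \<open>
  The variable \<open>w\<^sub>1\<^sub>,\<^sub>j\<^sub>+\<^sub>i\<close> (or its mirror image) is \<open>D\<^sup>i w\<^sub>1\<^sub>j\<close>; each step moves one \<open>D\<close> to the other
  factor at the cost of a sign and a total derivative.
\<close>

lemma weighted_sum_by_parts:
  assumes "\<And>i. a i \<in> box_functions"
  shows "\<exists>Q\<in>box_functions. (\<Sum>i<n. jet_var (nxt (\<not> b) (axis_var b (Suc (j + i)))) * a i) =
    jet_var (nxt (\<not> b) (axis_var b (Suc j))) * alt_sum (D b UNIV) n a + D b UNIV Q"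
  using assms
proof (induction n arbitrary: j a)
  case 0
  then show ?case by (intro bexI[of _ 0]) auto
next
  case (Suc n)
  let ?x = "\<lambda>j. jet_var (nxt (\<not> b) (axis_var b (Suc j)))" and ?S = "alt_sum (D b UNIV) n (\<lambda>i. a (Suc i))"
  have S: "?S \<in> box_functions" using Suc.prems by (auto intro: alt_sum_closed)
  have Dx: "D b UNIV (?x j) = ?x (Suc j)"
    by (cases b) (simp_all add: D_def vfield_jet_var axis_var_def)
  obtain Q where Q: "Q \<in> box_functions" "(\<Sum>i<n. ?x (Suc j + i) * a (Suc i)) = ?x (Suc j) * ?S + D b UNIV Q"
    using Suc.IH[of "\<lambda>i. a (Suc i)" "Suc j"] Suc.prems by auto
  have "D b UNIV (?x j * ?S + Q) = ?x (Suc j) * ?S + ?x j * D b UNIV ?S + D b UNIV Q"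
    using S Q(1) Dx by (simp add: D_def vfield_add vfield_mult)
  then have "(\<Sum>i<Suc n. ?x (j + i) * a i) = ?x j * alt_sum (D b UNIV) (Suc n) a + D b UNIV (?x j * ?S + Q)"
    using Q(2) by (simp add: sum.lessThan_Suc_shift algebra_simps del: sum.lessThan_Suc)
  then show ?case using S Q(1) by blast
qed

lemma D_UNIV_eq: "(\<And>c. c \<notin> S \<Longrightarrow> part c f = 0) \<Longrightarrow> D b UNIV f = D b S f"
  unfolding D_def by (rule vfield_cong) auto

lemma D_const_mult: "f \<in> box_functions \<Longrightarrow> D b S (const r * f) = const r * D b S f"
  by (simp add: D_def vfield_mult)

lemma alt_sum_total_eq_reduced:
  assumes "\<And>i. a i \<in> box_functions" "\<And>i c. c \<notin> line b - {W 0 0} \<Longrightarrow> part c (a i) = 0"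
  shows "alt_sum (D b UNIV) n a = alt_sum (D b (line b - {W 0 0})) n a"
    and "c \<notin> line b - {W 0 0} \<Longrightarrow> part c (alt_sum (D b (line b - {W 0 0})) n a) = 0"
proof -
  let ?R = "D b (line b - {W 0 0})"
  have "alt_sum (D b UNIV) n a = alt_sum ?R n a \<and>
      (\<forall>c. c \<notin> line b - {W 0 0} \<longrightarrow> part c (alt_sum ?R n a) = 0)"
    using assms
  proof (induction n arbitrary: a)
    case (Suc n)
    let ?S = "alt_sum ?R n (\<lambda>i. a (Suc i))"
    have S: "?S \<in> box_functions" using Suc.prems by (auto intro: alt_sum_closed)
    have IH: "alt_sum (D b UNIV) n (\<lambda>i. a (Suc i)) = ?S" "\<And>c. c \<notin> line b - {W 0 0} \<Longrightarrow> part c ?S = 0"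
      using Suc.IH[of "\<lambda>i. a (Suc i)"] Suc.prems by auto
    have "D b UNIV ?S = ?R ?S"
      by (rule D_UNIV_eq) (rule IH(2))
    moreover have "part c (?R ?S) = 0" if "c \<notin> line b - {W 0 0}" for c
      using IH(2)[OF that] S that by (subst part_D_line_commute) auto
    ultimately show ?case using IH Suc.prems S by (simp add: part_diff)
  qed simp
  then show "alt_sum (D b UNIV) n a = alt_sum ?R n a"
    "c \<notin> line b - {W 0 0} \<Longrightarrow> part c (alt_sum ?R n a) = 0" by auto
qed

lemma reduced_coords_subset: "reduced_coords b n \<subseteq> line b - {W 0 0}"
  by (auto simp: reduced_coords_def)

text \<open>
  For \<open>F = F(\<eta>, w\<^sub>0\<^sub>1, \<dots>)\<close>, the total derivative \<open>D\<^sub>\<xi> F\<close> is the sum of \<open>w\<^sub>1\<^sub>l \<partial>F/\<partial>w\<^sub>0\<^sub>l\<close>.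
  Integration by parts extracts the factor \<open>w\<^sub>1\<^sub>1\<close>, whose coefficient is the Euler sum.
\<close>

lemma euler_reduced_divergence:
  assumes F: "F \<in> box_functions" "\<And>c. c \<notin> reduced_coords b n \<Longrightarrow> part c F = 0"
  shows "\<exists>Q\<in>box_functions. euler b (line b - {W 0 0}) n F * jet_var (W 1 1) = D (\<not> b) UNIV F + D b UNIV Q"
proof -
  let ?a = "\<lambda>i. part (axis_var b (Suc i)) F"
  have a0: "part c (?a i) = 0" if "c \<notin> line b - {W 0 0}" for c i
  proof -
    have "part c F = 0" using F(2) reduced_coords_subset that by blast
    then show ?thesis using F(1) by (simp add: part_commute[of _ c])
  qed
  have W11: "nxt (\<not> b) (axis_var b (Suc 0)) = W 1 1" by (auto simp: axis_var_def)
  obtain Q where Q: "Q \<in> box_functions"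
    "(\<Sum>i<n. jet_var (nxt (\<not> b) (axis_var b (Suc i))) * ?a i) = jet_var (W 1 1) * alt_sum (D b UNIV) n ?a + D b UNIV Q"
    using weighted_sum_by_parts[of ?a b 0 n] F(1) W11 by auto
  have "D (\<not> b) UNIV F = (\<Sum>c\<in>reduced_coords b n. total_field (\<not> b) c * part c F)"
  proof -
    have "reduced_coords b n = insert (indep b) (axis_var b ` {1..n})" by (auto simp: reduced_coords_def)
    then have "finite (reduced_coords b n)" by simp
    then show ?thesis unfolding D_def using F(2) by (subst vfield_eq) auto
  qed
  also have "reduced_coords b n = insert (indep b) ((\<lambda>i. axis_var b (Suc i)) ` {..<n})"
    unfolding reduced_coords_def
    by (auto simp: image_iff) (metis One_nat_def Suc_le_D Suc_le_lessD lessThan_iff)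
  also have "(\<Sum>c\<in>\<dots>. total_field (\<not> b) c * part c F) = (\<Sum>i<n. jet_var (nxt (\<not> b) (axis_var b (Suc i))) * ?a i)"
    by (subst sum.insert) (auto simp: total_field_indep sum.reindex inj_on_def)
  finally have "D (\<not> b) UNIV F = jet_var (W 1 1) * euler b (line b - {W 0 0}) n F + D b UNIV Q"
    using Q(2) alt_sum_total_eq_reduced(1)[of ?a b n] F(1) a0 by (simp add: euler_def)
  then have "euler b (line b - {W 0 0}) n F * jet_var (W 1 1) = D (\<not> b) UNIV F + D b UNIV (- Q)"
    using Q(1) by (simp add: additive_op_uminus[OF additive_D] mult.commute)
  then show ?thesis using Q(1) by blast
qed

lemma euler_extend:
  assumes "F \<in> box_functions" "\<And>k. n < k \<Longrightarrow> part (axis_var b k) F = 0" "n \<le> m"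
  shows "euler b S m F = euler b S n F"
proof -
  have "alt_sum T m a = alt_sum T n a" if "additive_op T" "\<And>i. n \<le> i \<Longrightarrow> a i = 0" "n \<le> m" for T a n m
    using that
  proof (induction n arbitrary: m a)
    case 0
    then have "a = (\<lambda>i. 0)" by auto
    then show ?case using 0 by (simp add: alt_sum_0)
  next
    case (Suc n)
    then obtain m' where "m = Suc m'" "n \<le> m'" by (cases m) auto
    then show ?case using Suc.IH[of "\<lambda>i. a (Suc i)" m'] Suc.prems by simp
  qed
  then show ?thesis unfolding euler_def using assms by auto
qed

lemma euler_scale:
  assumes "F \<in> box_functions"
  shows "euler b S n (const r * F) = const r * euler b S n F"
proof -
  have "additive_op ((*) (const r))" by (auto simp: additive_op_def distrib_left)
  then have "const r * euler b S n F = alt_sum (D b S) n (\<lambda>l. const r * part (axis_var b (Suc l)) F)"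
    unfolding euler_def using assms
    by (intro alt_sum_image[of "D b S" "(*) (const r)" "D b S"]) (auto simp: D_const_mult)
  then show ?thesis using assms by (simp add: euler_def part_mult)
qed

text \<open>
  The distinguished form on a box, with one bound \<open>n\<close> for both orders; raising \<open>n\<close> is harmless by
  \<open>euler_extend\<close>, which makes sums of such functions easy to form.
\<close>

definition special_box :: "nat \<Rightarrow> (jet \<Rightarrow> real) \<Rightarrow> bool"
  where "special_box n \<mu> \<longleftrightarrow> (\<exists>F.
    (\<forall>b. F b \<in> box_functions \<and> (\<forall>c. c \<notin> reduced_coords b n \<longrightarrow> part c (F b) = 0)) \<and>
    \<mu> = euler True (line True - {W 0 0}) n (F True) + euler False (line False - {W 0 0}) n (F False))"

lemma special_box_closed: "special_box n \<mu> \<Longrightarrow> \<mu> \<in> box_functions"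
  by (auto simp: special_box_def)

lemma special_box_add:
  assumes "special_box n \<mu>" "special_box n \<nu>"
  shows "special_box n (\<mu> + \<nu>)"
proof -
  obtain F G where
    "\<And>b. F b \<in> box_functions" "\<And>b c. c \<notin> reduced_coords b n \<Longrightarrow> part c (F b) = 0"
    "\<mu> = euler True (line True - {W 0 0}) n (F True) + euler False (line False - {W 0 0}) n (F False)"
    "\<And>b. G b \<in> box_functions" "\<And>b c. c \<notin> reduced_coords b n \<Longrightarrow> part c (G b) = 0"
    "\<nu> = euler True (line True - {W 0 0}) n (G True) + euler False (line False - {W 0 0}) n (G False)"
    using assms unfolding special_box_def by metis
  then show ?thesis
    unfolding special_box_def
    by (intro exI[of _ "\<lambda>b. F b + G b"]) (auto simp: part_add euler_add add_ac)
qed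

lemma special_box_scale:
  assumes "special_box n \<mu>"
  shows "special_box n (const r * \<mu>)"
proof -
  obtain F where
    "\<And>b. F b \<in> box_functions" "\<And>b c. c \<notin> reduced_coords b n \<Longrightarrow> part c (F b) = 0"
    "\<mu> = euler True (line True - {W 0 0}) n (F True) + euler False (line False - {W 0 0}) n (F False)"
    using assms unfolding special_box_def by metis
  then show ?thesis
    unfolding special_box_def
    by (intro exI[of _ "\<lambda>b. const r * F b"]) (auto simp: part_mult euler_scale distrib_left)
qed

lemma special_box_divergence:
  assumes "special_box n \<mu>"
  shows "\<exists>P\<in>box_functions. \<exists>Q\<in>box_functions. \<mu> * jet_var (W 1 1) = D True UNIV P + D False UNIV Q"
proof -
  obtain F where F: "\<And>b. F b \<in> box_functions" "\<And>b c. c \<notin> reduced_coords b n \<Longrightarrow> part c (F b) = 0"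
    and \<mu>: "\<mu> = euler True (line True - {W 0 0}) n (F True) + euler False (line False - {W 0 0}) n (F False)"
    using assms unfolding special_box_def by metis
  obtain P Q where "P \<in> box_functions" "Q \<in> box_functions"
    "euler True (line True - {W 0 0}) n (F True) * jet_var (W 1 1) = D False UNIV (F True) + D True UNIV P"
    "euler False (line False - {W 0 0}) n (F False) * jet_var (W 1 1) = D True UNIV (F False) + D False UNIV Q"
    using euler_reduced_divergence[of "F True" True n] euler_reduced_divergence[of "F False" False n] F by auto
  then have "\<mu> * jet_var (W 1 1) = D True UNIV (P + F False) + D False UNIV (Q + F True)"
    using F by (simp only: \<mu> distrib_right) (simp add: additive_op_add[OF additive_D] add_ac)
  then show ?thesis using F \<open>P \<in> box_functions\<close> \<open>Q \<in> box_functions\<close> by blast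
qed

lemma special_box_part_mixed:
  assumes "special_box n \<mu>" "c \<in> mixed"
  shows "part c \<mu> = 0"
proof -
  obtain F where F: "\<And>b. F b \<in> box_functions" "\<And>b c. c \<notin> reduced_coords b n \<Longrightarrow> part c (F b) = 0"
    and \<mu>: "\<mu> = euler True (line True - {W 0 0}) n (F True) + euler False (line False - {W 0 0}) n (F False)"
    using assms unfolding special_box_def by metis
  have "part c (euler b (line b - {W 0 0}) n (F b)) = 0" for b
    unfolding euler_def
  proof (rule alt_sum_total_eq_reduced(2))
    show "c \<notin> line b - {W 0 0}" using line_mixed assms(2) by blast
    show "part d (part (axis_var b (Suc i)) (F b)) = 0" if "d \<notin> line b - {W 0 0}" for i d
    proof -
      have "part d (F b) = 0" using F(2) reduced_coords_subset that by blast
      then show ?thesis using F(1) by (simp add: part_commute[of _ d])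
    qed
  qed (use F in auto)
  then show ?thesis using F by (simp add: \<mu> part_add)
qed

theorem characteristic_eq_special_on_solutions:
  assumes p: "p \<in> solution_set" and \<mu>: "\<mu> \<in> box_functions"
    and PQ: "P \<in> box_functions" "Q \<in> box_functions"
    and eq: "\<mu> * jet_var (W 1 1) = D True UNIV P + D False UNIV Q"
  shows "\<exists>n. special_box n (freeze mixed \<mu>)"
proof -
  \<comment> \<open>\<open>J b\<close> is the component differentiated in direction \<open>b\<close>.\<close>
  define J where "J = (\<lambda>b. if b then P else Q)"
  have J: "J b \<in> box_functions" for b using PQ by (simp add: J_def)
  have "finite (\<Union>b. {c. part c (J b) \<noteq> 0})" using finite_support J by auto
  then have "finite ((\<lambda>c. case c of W k l \<Rightarrow> k + l | _ \<Rightarrow> 0) ` (\<Union>b. {c. part c (J b) \<noteq> 0}))" by simp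
  then obtain m where "\<forall>i\<in>(\<lambda>c. case c of W k l \<Rightarrow> k + l | _ \<Rightarrow> 0) ` (\<Union>b. {c. part c (J b) \<noteq> 0}). i \<le> m"
    unfolding finite_nat_set_iff_bounded_le by blast
  then have m: "(case c of W k l \<Rightarrow> k + l | _ \<Rightarrow> 0) \<le> m" if "part c (J b) \<noteq> 0" for b c
    using that by blast
  define n where "n = m + 2"
  have n: "part (W k l) (J b) = 0" if "n \<le> k \<or> n \<le> l" for b k l
    by (rule ccontr) (use m[of "W k l" b] that in \<open>auto simp: n_def\<close>)
  \<comment> \<open>The Euler sum of direction \<open>b\<close> acts on the component of the opposite direction.\<close>
  define R where "R = (\<lambda>b. freeze mixed (J (\<not> b)))"
  have R: "R b \<in> box_functions" for b using J by (simp add: R_def)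
  note on = characteristic_on_solutions[OF p \<mu>, of J n]
  have form: "freeze mixed \<mu> = euler True (line True) n (R True) + euler False (line False) n (R False)"
    using on(1) J eq n by (simp add: J_def R_def n_def add.commute)
  have sum0: "D True (line True) (R False) + D False (line False) (R True) = 0"
    using on(2) J eq n by (simp add: J_def R_def n_def)
  have "\<exists>F. (\<forall>b. F b \<in> box_functions \<and>
        (\<forall>c. c \<notin> insert (indep b) {axis_var b k |k. 1 \<le> k \<and> k \<le> n} \<longrightarrow> part c (F b) = 0)) \<and>
      euler True (line True) n (R True) + euler False (line False) n (R False) =
        euler True (line True - {W 0 0}) n (F True) + euler False (line False - {W 0 0}) n (F False)"
  proof (rule on_shell_characteristic_form[OF R])
    show "part c (R b) = 0" if "c \<in> mixed" for b c using that J by (simp add: R_def part_freeze)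
    show "D (\<not> b) (line (\<not> b)) (R b) = - D b (line b) (R (\<not> b))" for b
      using sum0 by (cases b) (simp_all add: eq_neg_iff_add_eq_0 add.commute)
    show "2 \<le> n" by (simp add: n_def)
    show "part (axis_var d k) (R b) = 0" if "n \<le> k" for b d k
      using that J n[of k 0 "\<not> b"] n[of 0 k "\<not> b"] by (auto simp: R_def part_freeze axis_var_def)
  qed
  then show ?thesis unfolding special_box_def reduced_coords_def form by blast
qed

end

section \<open>Differential functions in small boxes\<close>

text \<open>
  The property holds for all sufficiently small boxes; finitely many such properties hold on a common box.
\<close>

definition near_box :: "jet \<Rightarrow> (jet set \<Rightarrow> bool) \<Rightarrow> bool"
  where "near_box p Q \<longleftrightarrow> (\<exists>U. open U \<and> p \<in> U \<and> (\<forall>B\<subseteq>U. jet_box p B \<longrightarrow> Q B))"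

lemma near_boxI: "open U \<Longrightarrow> p \<in> U \<Longrightarrow> (\<And>B. B \<subseteq> U \<Longrightarrow> jet_box p B \<Longrightarrow> Q B) \<Longrightarrow> near_box p Q"
  by (auto simp: near_box_def)

lemma near_boxE:
  assumes "near_box p Q"
  obtains B where "jet_box p B" "Q B"
  using assms box_in_open unfolding near_box_def by blast

lemma near_box_conj:
  assumes "near_box p P" "near_box p Q"
  shows "near_box p (\<lambda>B. P B \<and> Q B)"
proof -
  obtain U V where "open U" "p \<in> U" "\<And>B. B \<subseteq> U \<Longrightarrow> jet_box p B \<Longrightarrow> P B"
    "open V" "p \<in> V" "\<And>B. B \<subseteq> V \<Longrightarrow> jet_box p B \<Longrightarrow> Q B"
    using assms unfolding near_box_def by blast
  then show ?thesis by (intro near_boxI[of "U \<inter> V"]) auto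
qed

lemma near_box_mono:
  "near_box p P \<Longrightarrow> (\<And>B. jet_box p B \<Longrightarrow> P B \<Longrightarrow> Q B) \<Longrightarrow> near_box p Q"
  unfolding near_box_def by blast

lemma near_box_eventually: "\<forall>\<^sub>F x in nhds p. P x \<Longrightarrow> near_box p (\<lambda>B. \<forall>x\<in>B. P x)"
  unfolding eventually_nhds near_box_def by blast

lemma pd_lagrangian:
  "pd (W k l) lagrangian x =
    (if k = 1 \<and> l = 0 then - x (W 0 1) / 2 else if k = 0 \<and> l = 1 then - x (W 1 0) / 2 else 0)"
proof -
  have "((\<lambda>t. lagrangian (x(W k l := t))) has_real_derivative
      (if k = 1 \<and> l = 0 then - x (W 0 1) / 2 else if k = 0 \<and> l = 1 then - x (W 1 0) / 2 else 0)) (at (x (W k l)))"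
    unfolding lagrangian_def by (auto intro!: derivative_eq_intros)
  then show ?thesis unfolding pd_def by (rule DERIV_imp_deriv)
qed

lemma prolongation_lagrangian:
  "prolongation \<mu> lagrangian x = - (D_xi \<mu> x * x (W 0 1) + D_eta \<mu> x * x (W 1 0)) / 2"
proof -
  have "prolongation \<mu> lagrangian x =
    (\<Sum>(k, l)\<in>{(1, 0), (0, 1)}. (D_xi ^^ k) ((D_eta ^^ l) \<mu>) x * pd (W k l) lagrangian x)"
    unfolding prolongation_def
    by (rule sum.mono_neutral_left) (auto simp: pd_lagrangian split: if_splits)
  then show ?thesis by (simp add: pd_lagrangian field_simps)
qed

context jet_box
begin

lemma pd_eq_part: "x \<in> B \<Longrightarrow> pd c f x = part c (cut f) x"
  using part_cong[of f "cut f" c] by (metis cut_in part_def)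

lemma const_in [simp]: "x \<in> B \<Longrightarrow> const r x = r"
  and jet_var_in [simp]: "x \<in> B \<Longrightarrow> jet_var c x = x c"
  by (simp_all add: const_def jet_var_def)

lemma cut_0 [simp]: "cut 0 = 0"
  by (simp add: fun_eq_iff cut_def pointwise)

lemma cut_add: "cut (f + g) = cut f + cut g"
  and cut_uminus: "cut (- f) = - cut f"
  and cut_scale: "cut (\<lambda>x. r * f x) = const r * cut f"
  by (auto simp: fun_eq_iff cut_def const_def pointwise)

lemma cut_closed:
  assumes "jet_smooth_on U f" "depends_only_on U S f" "finite S" "B \<subseteq> U"
  shows "cut f \<in> box_functions" and "c \<notin> S \<Longrightarrow> part c (cut f) = 0"
proof -
  have "jet_smooth_on B f"
    using assms(1,4) unfolding jet_smooth_on_def by (blast intro: continuous_on_subset)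
  then have "jet_smooth_on B (cut f)" by (rule jet_smooth_cong[rotated]) simp
  moreover have dep: "depends_only_on B S (cut f)"
    using assms(2,4) by (auto simp: depends_only_on_def subset_iff)
  ultimately show "cut f \<in> box_functions" using assms(3) by (intro box_functionsI) auto
  show "part c (cut f) = 0" if "c \<notin> S" using part_eq_0_if_depends[OF dep that] .
qed

lemma smooth_functions_ofI:
  assumes "f \<in> box_functions" "\<And>c. c \<notin> S \<Longrightarrow> part c f = 0"
  shows "f \<in> smooth_functions_of p S"
  using depends_if_part_eq_0[OF assms] box_functionsE[OF assms(1)] open_B p_in_B
  unfolding smooth_functions_of_def by blast

lemma diff_functionsI:
  assumes "cut f \<in> box_functions"
  shows "f \<in> diff_functions p"
proof -
  obtain S where S: "jet_smooth_on B (cut f)" "finite S" "depends_only_on B S (cut f)"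
    using assms by (auto elim: box_functionsE)
  have "jet_smooth_on B f" by (rule jet_smooth_cong[OF _ S(1)]) simp
  moreover have "depends_only_on B S f" 
    unfolding depends_only_on_def
  proof (intro ballI impI)
    fix x y assume "x \<in> B" "y \<in> B" "\<forall>c\<in>S. x c = y c"
    moreover from this have "cut f x = cut f y" using S(3) unfolding depends_only_on_def by blast
    ultimately show "f x = f y" by simp
  qed
  ultimately show ?thesis
    using S(2) open_B p_in_B unfolding diff_functions_def smooth_functions_of_def by blast
qed

lemma vfield_at:
  assumes f: "f \<in> box_functions"
  shows "vfield v f x = v Xi x * part Xi f x + v Eta x * part Eta f x +
    (\<Sum>(k, l) | part (W k l) f x \<noteq> 0. v (W k l) x * part (W k l) f x)"
    and "finite {(k, l). part (W k l) f x \<noteq> 0}"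
proof -
  let ?K = "{(k, l). part (W k l) f x \<noteq> 0}" and ?w = "\<lambda>(k, l). W k l"
  have inj: "inj_on ?w A" for A by (auto simp: inj_on_def)
  have "?w ` ?K \<subseteq> {c. part c f \<noteq> 0}" by (auto simp: pointwise)
  then have "finite (?w ` ?K)" using finite_support[OF f] finite_subset by blast
  then show K: "finite ?K" using inj finite_imageD by blast
  have "vfield v f x = (\<Sum>c | part c f \<noteq> 0. v c x * part c f x)"
    by (simp add: vfield_def pointwise)
  also have "\<dots> = (\<Sum>c | part c f x \<noteq> 0. v c x * part c f x)"
    by (rule sum.mono_neutral_right) (auto simp: finite_support[OF f] pointwise)
  also have "\<dots> = (\<Sum>c\<in>insert Xi (insert Eta (?w ` ?K)). v c x * part c f x)"
  proof (rule sum.mono_neutral_left)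
    show "{c. part c f x \<noteq> 0} \<subseteq> insert Xi (insert Eta (?w ` ?K))"
    proof
      fix c assume "c \<in> {c. part c f x \<noteq> 0}"
      then show "c \<in> insert Xi (insert Eta (?w ` ?K))" by (cases c) auto
    qed
  qed (use K in auto)
  also have "\<dots> = v Xi x * part Xi f x + v Eta x * part Eta f x + (\<Sum>c\<in>?w ` ?K. v c x * part c f x)"
  proof -
    have "Eta \<notin> ?w ` ?K" "Xi \<notin> insert Eta (?w ` ?K)" by auto
    then show ?thesis using K by (simp add: add.assoc)
  qed
  also have "(\<Sum>c\<in>?w ` ?K. v c x * part c f x) = (\<Sum>(k, l)\<in>?K. v (W k l) x * part (W k l) f x)"
    by (subst sum.reindex[OF inj]) (simp add: case_prod_beta)
  finally show "vfield v f x = v Xi x * part Xi f x + v Eta x * part Eta f x +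
    (\<Sum>(k, l) | part (W k l) f x \<noteq> 0. v (W k l) x * part (W k l) f x)" .
qed

lemma D_xi_at: "cut f \<in> box_functions \<Longrightarrow> x \<in> B \<Longrightarrow> D_xi f x = D True UNIV (cut f) x"
  and D_eta_at: "cut f \<in> box_functions \<Longrightarrow> x \<in> B \<Longrightarrow> D_eta f x = D False UNIV (cut f) x"
  by (auto simp: D_xi_def D_eta_def D_def vfield_at pd_eq_part total_field_def indep_def const_def jet_var_def pointwise)

lemma RD_xi_at: "cut f \<in> box_functions \<Longrightarrow> x \<in> B \<Longrightarrow> RD_xi f x = D True (line True - {W 0 0}) (cut f) x"
proof -
  assume f: "cut f \<in> box_functions" and x: "x \<in> B"
  let ?g = "cut f"
  have line: "W k l \<in> line True \<longleftrightarrow> l = 0" "Xi \<in> line True" "Eta \<notin> line True" for k l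
    by (auto simp: line_def axis_var_def indep_def)
  have "(\<Sum>k | 1 \<le> k \<and> part (W k 0) ?g x \<noteq> 0. x (W (Suc k) 0) * part (W k 0) ?g x) =
      (\<Sum>(k, l)\<in>(\<lambda>k. (k, 0)) ` {k. 1 \<le> k \<and> part (W k 0) ?g x \<noteq> 0}. x (W (Suc k) l) * part (W k l) ?g x)"
    by (subst sum.reindex) (auto simp: inj_on_def)
  also have "\<dots> = (\<Sum>(k, l) | part (W k l) ?g x \<noteq> 0.
      (if W k l \<in> line True - {W 0 0} then total_field True (W k l) else 0) x * part (W k l) ?g x)"
    by (rule sum.mono_neutral_cong_left[OF vfield_at(2)[OF f]]) (use x in \<open>auto simp: line jet_var_def pointwise\<close>)
  finally show ?thesis
    using f x by (simp add: RD_xi_def D_def vfield_at pd_eq_part line)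
      (simp add: total_field_def indep_def const_def pointwise)
qed

lemma RD_eta_at: "cut f \<in> box_functions \<Longrightarrow> x \<in> B \<Longrightarrow> RD_eta f x = D False (line False - {W 0 0}) (cut f) x"
proof -
  assume f: "cut f \<in> box_functions" and x: "x \<in> B"
  let ?g = "cut f"
  have line: "W k l \<in> line False \<longleftrightarrow> k = 0" "Eta \<in> line False" "Xi \<notin> line False" for k l
    by (auto simp: line_def axis_var_def indep_def)
  have "(\<Sum>l | 1 \<le> l \<and> part (W 0 l) ?g x \<noteq> 0. x (W 0 (Suc l)) * part (W 0 l) ?g x) =
      (\<Sum>(k, l)\<in>Pair 0 ` {l. 1 \<le> l \<and> part (W 0 l) ?g x \<noteq> 0}. x (W k (Suc l)) * part (W k l) ?g x)"
    by (subst sum.reindex) (auto simp: inj_on_def)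
  also have "\<dots> = (\<Sum>(k, l) | part (W k l) ?g x \<noteq> 0.
      (if W k l \<in> line False - {W 0 0} then total_field False (W k l) else 0) x * part (W k l) ?g x)"
    by (rule sum.mono_neutral_cong_left[OF vfield_at(2)[OF f]]) (use x in \<open>auto simp: line jet_var_def pointwise\<close>)
  finally show ?thesis
    using f x by (simp add: RD_eta_def D_def vfield_at pd_eq_part line)
      (simp add: total_field_def indep_def const_def pointwise)
qed

text \<open>
  Operators on germs and on functions cut off to the box agree, and so do their iterates, because cutting
  off does not affect derivatives inside the open box.
\<close>

lemma iterate_at:
  assumes f: "cut f \<in> box_functions"
    and T: "\<And>g x. cut g \<in> box_functions \<Longrightarrow> x \<in> B \<Longrightarrow> T g x = D b S (cut g) x"
  shows "cut (((\<lambda>f. - T f) ^^ i) f) = ((\<lambda>f. - D b S f) ^^ i) (cut f)"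
    and "cut (((\<lambda>f. - T f) ^^ i) f) \<in> box_functions"
proof -
  have "cut (((\<lambda>f. - T f) ^^ i) f) = ((\<lambda>f. - D b S f) ^^ i) (cut f) \<and>
      cut (((\<lambda>f. - T f) ^^ i) f) \<in> box_functions"
  proof (induction i)
    case (Suc i)
    let ?g = "((\<lambda>f. - T f) ^^ i) f"
    have g: "cut ?g \<in> box_functions" using Suc by blast
    have "cut (T ?g) = D b S (cut ?g)"
    proof
      fix x show "cut (T ?g) x = D b S (cut ?g) x"
        by (cases "x \<in> B") (simp_all add: T[OF g] box_functions_outside[OF D_closed[OF g]])
    qed
    then have "cut (- T ?g) = - D b S (cut ?g)" by (simp add: cut_uminus)
    moreover have "- D b S (cut ?g) \<in> box_functions" using g by simp
    ultimately show ?case using Suc by (simp only: funpow.simps comp_apply simp_thms)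
  qed (use f in auto)
  then show "cut (((\<lambda>f. - T f) ^^ i) f) = ((\<lambda>f. - D b S f) ^^ i) (cut f)"
    "cut (((\<lambda>f. - T f) ^^ i) f) \<in> box_functions" by auto
qed

lemma euler_at:
  assumes f: "cut f \<in> box_functions" and x: "x \<in> B"
    and T: "\<And>g x. cut g \<in> box_functions \<Longrightarrow> x \<in> B \<Longrightarrow> T g x = D b S (cut g) x"
  shows "(\<Sum>l = 1..n. ((\<lambda>f. - T f) ^^ (l - 1)) (pd (axis_var b l) f) x) = euler b S n (cut f) x"
proof -
  have pd: "cut (pd c f) = part c (cut f)" for c
    using pd_eq_part[of _ c f] by (auto simp: cut_def[of "pd c f"] fun_eq_iff box_functions_outside f)
  have "(\<Sum>l = 1..n. ((\<lambda>f. - T f) ^^ (l - 1)) (pd (axis_var b l) f) x) =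
      (\<Sum>i<n. ((\<lambda>f. - T f) ^^ i) (pd (axis_var b (Suc i)) f) x)"
    by (simp add: sum.atLeast1_atMost_eq)
  also have "\<dots> = (\<Sum>i<n. ((\<lambda>f. - D b S f) ^^ i) (part (axis_var b (Suc i)) (cut f)) x)"
  proof (rule sum.cong[OF refl])
    fix i
    have "cut (pd (axis_var b (Suc i)) f) \<in> box_functions" using f by (simp add: pd)
    from iterate_at(1)[OF this T, of i]
    show "((\<lambda>f. - T f) ^^ i) (pd (axis_var b (Suc i)) f) x =
        ((\<lambda>f. - D b S f) ^^ i) (part (axis_var b (Suc i)) (cut f)) x"
      using x by (simp add: pd fun_eq_iff cut_def[of "((\<lambda>f. - T f) ^^ i) _"] split: if_splits)
  qed
  also have "\<dots> = euler b S n (cut f) x"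
    using f by (simp add: euler_def alt_sum_eq_sum sum_fun_apply)
  finally show ?thesis .
qed

lemma special_form_at:
  assumes "cut F \<in> box_functions" "cut G \<in> box_functions" "x \<in> B"
  shows "special_form r\<^sub>1 r\<^sub>2 F G x =
    euler False (line False - {W 0 0}) r\<^sub>1 (cut F) x + euler True (line True - {W 0 0}) r\<^sub>2 (cut G) x"
  using euler_at[OF assms(1,3), of RD_eta False] euler_at[OF assms(2,3), of RD_xi True]
  by (simp add: special_form_def axis_var_def RD_xi_at RD_eta_at)

lemma total_divergenceI:
  assumes "P \<in> box_functions" "Q \<in> box_functions"
    and "\<And>x. x \<in> B \<Longrightarrow> f x = D True UNIV P x + D False UNIV Q x"
  shows "total_divergence p f"
proof -
  have "\<forall>\<^sub>F x in nhds p. x \<in> B" using open_B p_in_B by (auto simp: eventually_nhds)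
  then have "\<forall>\<^sub>F x in nhds p. f x = D_xi P x + D_eta Q x"
    by eventually_elim (use assms in \<open>simp add: D_xi_at D_eta_at\<close>)
  moreover have "P \<in> diff_functions p" "Q \<in> diff_functions p"
    using assms by (auto intro!: diff_functionsI)
  ultimately show ?thesis unfolding total_divergence_def by blast
qed

lemma reduced_coords_eq:
  "reduced_coords False n = insert Eta {W 0 l |l. 1 \<le> l \<and> l \<le> n}"
  "reduced_coords True n = insert Xi {W k 0 |k. 1 \<le> k \<and> k \<le> n}"
  by (auto simp: reduced_coords_def axis_var_def indep_def)

lemma special_functionsI:
  assumes "special_box n (cut \<mu>)"
  shows "\<mu> \<in> special_functions p"
proof -
  obtain F where F: "\<And>b. F b \<in> box_functions" "\<And>b c. c \<notin> reduced_coords b n \<Longrightarrow> part c (F b) = 0"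
    and \<mu>: "cut \<mu> = euler True (line True - {W 0 0}) n (F True) + euler False (line False - {W 0 0}) n (F False)"
    using assms unfolding special_box_def by metis
  have "\<forall>\<^sub>F x in nhds p. x \<in> B" using open_B p_in_B by (auto simp: eventually_nhds)
  then have "\<forall>\<^sub>F x in nhds p. \<mu> x = special_form n n (F False) (F True) x"
  proof eventually_elim
    case (elim x)
    have "\<mu> x = cut \<mu> x" using elim by simp
    then show ?case using F elim by (simp add: special_form_at \<mu> plus_fun_apply)
  qed
  moreover have "F b \<in> smooth_functions_of p (reduced_coords b n)" for b
    using F by (intro smooth_functions_ofI)
  ultimately show ?thesis unfolding special_functions_def reduced_coords_eq[symmetric] by blast
qed

text \<open>
  By the product rule, \<open>D\<^sub>\<xi> \<mu> w\<^sub>0\<^sub>1 = D\<^sub>\<xi> (\<mu> w\<^sub>0\<^sub>1) - \<mu> w\<^sub>1\<^sub>1\<close>, and likewise for the other term of the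
  prolongation.  This is Noether's theorem for the given Lagrangian.
\<close>

lemma prolongation_eq_characteristic:
  assumes M: "cut \<mu> \<in> box_functions"
  shows "\<exists>P\<in>box_functions. \<exists>Q\<in>box_functions. \<forall>x\<in>B.
    prolongation \<mu> lagrangian x - \<mu> x * x (W 1 1) = D True UNIV P x + D False UNIV Q x"
proof -
  let ?M = "cut \<mu>" and ?h = "const (- (1 / 2))"
  let ?P = "?h * (?M * jet_var (W 0 1))" and ?Q = "?h * (?M * jet_var (W 1 0))"
  have DX: "D True UNIV (jet_var (W 0 1)) = jet_var (W 1 1)" "D False UNIV (jet_var (W 1 0)) = jet_var (W 1 1)"
    by (simp_all add: D_def vfield_jet_var)
  have "D True UNIV ?P = ?h * (D True UNIV ?M * jet_var (W 0 1) + ?M * jet_var (W 1 1))"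
    "D False UNIV ?Q = ?h * (D False UNIV ?M * jet_var (W 1 0) + ?M * jet_var (W 1 1))"
    using M DX by (simp_all add: D_def vfield_mult)
  then have "prolongation \<mu> lagrangian x - \<mu> x * x (W 1 1) = D True UNIV ?P x + D False UNIV ?Q x"
    if "x \<in> B" for x
    using that M
    by (simp add: prolongation_lagrangian D_xi_at D_eta_at pointwise const_def jet_var_def field_simps)
  then show ?thesis using M by (intro bexI[of _ ?P] bexI[of _ ?Q]) auto
qed

end

section \<open>From germs to small boxes\<close>

lemma smooth_functions_near:
  assumes "f \<in> smooth_functions_of p S" "finite S"
  shows "near_box p (\<lambda>B. jet_box.cut B f \<in> jet_box.box_functions B \<and>
    (\<forall>c. c \<notin> S \<longrightarrow> jet_box.part B c (jet_box.cut B f) = 0))"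
proof -
  obtain U where U: "open U" "p \<in> U" "jet_smooth_on U f" "depends_only_on U S f"
    using assms(1) by (auto simp: smooth_functions_of_def)
  show ?thesis
  proof (rule near_boxI[OF U(1,2)])
    fix B assume B: "B \<subseteq> U" "jet_box p B"
    show "jet_box.cut B f \<in> jet_box.box_functions B \<and>
        (\<forall>c. c \<notin> S \<longrightarrow> jet_box.part B c (jet_box.cut B f) = 0)"
      using jet_box.cut_closed[OF B(2) U(3,4) assms(2) B(1)] by blast
  qed
qed

lemma diff_functions_near:
  assumes "f \<in> diff_functions p"
  shows "near_box p (\<lambda>B. jet_box.cut B f \<in> jet_box.box_functions B)"
proof -
  obtain S where "f \<in> smooth_functions_of p S" "finite S"
    using assms unfolding diff_functions_def by blast
  from smooth_functions_near[OF this] show ?thesis by (rule near_box_mono) (rule conjunct1)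
qed

lemma total_divergence_near:
  assumes "total_divergence p f"
  shows "near_box p (\<lambda>B. \<exists>P\<in>jet_box.box_functions B. \<exists>Q\<in>jet_box.box_functions B.
    \<forall>x\<in>B. f x = jet_box.D B True UNIV P x + jet_box.D B False UNIV Q x)"
proof -
  obtain P Q where "P \<in> diff_functions p" "Q \<in> diff_functions p"
      "\<forall>\<^sub>F x in nhds p. f x = D_xi P x + D_eta Q x"
    using assms unfolding total_divergence_def by blast
  then have "near_box p (\<lambda>B. jet_box.cut B P \<in> jet_box.box_functions B \<and>
      jet_box.cut B Q \<in> jet_box.box_functions B \<and> (\<forall>x\<in>B. f x = D_xi P x + D_eta Q x))"
    by (intro near_box_conj diff_functions_near near_box_eventually)
  then show ?thesis
  proof (rule near_box_mono)
    fix B assume "jet_box p B"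
    then interpret jet_box p B .
    assume "cut P \<in> box_functions \<and> cut Q \<in> box_functions \<and> (\<forall>x\<in>B. f x = D_xi P x + D_eta Q x)"
    then show "\<exists>P\<in>box_functions. \<exists>Q\<in>box_functions. \<forall>x\<in>B. f x = D True UNIV P x + D False UNIV Q x"
      by (intro bexI[of _ "cut P"] bexI[of _ "cut Q"]) (auto simp: D_xi_at D_eta_at)
  qed
qed

lemma total_divergence_add:
  assumes "total_divergence p f" "total_divergence p g" "\<And>x. h x = f x + g x"
  shows "total_divergence p h"
proof -
  obtain B where B: "jet_box p B"
    and fg: "(\<exists>P\<in>jet_box.box_functions B. \<exists>Q\<in>jet_box.box_functions B.
        \<forall>x\<in>B. f x = jet_box.D B True UNIV P x + jet_box.D B False UNIV Q x) \<and>
      (\<exists>P\<in>jet_box.box_functions B. \<exists>Q\<in>jet_box.box_functions B.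
        \<forall>x\<in>B. g x = jet_box.D B True UNIV P x + jet_box.D B False UNIV Q x)"
    by (rule near_boxE[OF near_box_conj[OF assms(1,2)[THEN total_divergence_near]]])
  interpret jet_box p B by fact
  obtain P Q where "P \<in> box_functions" "Q \<in> box_functions"
    "\<And>x. x \<in> B \<Longrightarrow> f x = D True UNIV P x + D False UNIV Q x"
    using conjunct1[OF fg] by blast
  moreover obtain P' Q' where "P' \<in> box_functions" "Q' \<in> box_functions"
    "\<And>x. x \<in> B \<Longrightarrow> g x = D True UNIV P' x + D False UNIV Q' x"
    using conjunct2[OF fg] by blast
  ultimately show ?thesis
    by (intro total_divergenceI[of "P + P'" "Q + Q'"])
      (auto simp: assms(3) additive_op_add[OF additive_D] plus_fun_apply)
qed

lemma total_divergence_scale: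
  assumes "total_divergence p f" "\<And>x. h x = r * f x"
  shows "total_divergence p h"
proof -
  obtain B where B: "jet_box p B"
    and f: "\<exists>P\<in>jet_box.box_functions B. \<exists>Q\<in>jet_box.box_functions B.
        \<forall>x\<in>B. f x = jet_box.D B True UNIV P x + jet_box.D B False UNIV Q x"
    by (rule near_boxE[OF total_divergence_near[OF assms(1)]])
  interpret jet_box p B by fact
  obtain P Q where "P \<in> box_functions" "Q \<in> box_functions"
    "\<And>x. x \<in> B \<Longrightarrow> f x = D True UNIV P x + D False UNIV Q x"
    using f by blast
  then show ?thesis
    by (intro total_divergenceI[of "const r * P" "const r * Q"])
      (auto simp: assms(2) D_const_mult times_fun_apply distrib_left)
qed

lemma diff_functions_add:
  assumes "f \<in> diff_functions p" "g \<in> diff_functions p"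
  shows "f + g \<in> diff_functions p"
proof -
  obtain B where B: "jet_box p B"
    "jet_box.cut B f \<in> jet_box.box_functions B \<and> jet_box.cut B g \<in> jet_box.box_functions B"
    by (rule near_boxE[OF near_box_conj[OF assms[THEN diff_functions_near]]])
  interpret jet_box p B by fact
  show ?thesis using B(2) by (intro diff_functionsI) (simp add: cut_add)
qed

lemma diff_functions_scale:
  assumes "f \<in> diff_functions p"
  shows "(\<lambda>x. r * f x) \<in> diff_functions p"
proof -
  obtain B where B: "jet_box p B" "jet_box.cut B f \<in> jet_box.box_functions B"
    by (rule near_boxE[OF diff_functions_near[OF assms]])
  interpret jet_box p B by fact
  show ?thesis using B(2) by (intro diff_functionsI) (simp add: cut_scale)
qed

section \<open>Variational symmetries\<close>

lemma variational_symmetries_eq_cl_characteristics: "variational_symmetries p = cl_characteristics p"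
proof -
  have "total_divergence p (prolongation \<mu> lagrangian) \<longleftrightarrow> total_divergence p (\<lambda>x. \<mu> x * x (W 1 1))"
    if \<mu>: "\<mu> \<in> diff_functions p" for \<mu>
  proof -
    obtain B where B: "jet_box p B" "jet_box.cut B \<mu> \<in> jet_box.box_functions B"
      by (rule near_boxE[OF diff_functions_near[OF \<mu>]])
    interpret jet_box p B by fact
    obtain P Q where PQ: "P \<in> box_functions" "Q \<in> box_functions"
      "\<And>x. x \<in> B \<Longrightarrow> prolongation \<mu> lagrangian x - \<mu> x * x (W 1 1) = D True UNIV P x + D False UNIV Q x"
      using prolongation_eq_characteristic[OF B(2)] by blast
    have *: "total_divergence p (\<lambda>x. prolongation \<mu> lagrangian x - \<mu> x * x (W 1 1))"
      by (rule total_divergenceI[OF PQ])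
    have **: "total_divergence p (\<lambda>x. - 1 * (prolongation \<mu> lagrangian x - \<mu> x * x (W 1 1)))"
      by (rule total_divergence_scale[OF *, of _ "- 1"]) simp
    show ?thesis
    proof
      assume "total_divergence p (prolongation \<mu> lagrangian)"
      from total_divergence_add[OF this **] show "total_divergence p (\<lambda>x. \<mu> x * x (W 1 1))" by simp
    next
      assume "total_divergence p (\<lambda>x. \<mu> x * x (W 1 1))"
      from total_divergence_add[OF this *] show "total_divergence p (prolongation \<mu> lagrangian)" by simp
    qed
  qed
  then show ?thesis by (auto simp: variational_symmetries_def cl_characteristics_def)
qed

lemma subspace_cl_characteristics: "jetfun.subspace (cl_characteristics p)"
proof -
  obtain B where B: "jet_box p B" using box_in_open[of UNIV p] by auto
  interpret jet_box p B by fact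
  have "0 \<in> cl_characteristics p"
  proof -
    have "0 \<in> diff_functions p" by (rule diff_functionsI) simp
    moreover have "total_divergence p (\<lambda>x. 0 x * x (W 1 1))"
      by (rule total_divergenceI[of 0 0]) (simp_all add: zero_fun_apply)
    ultimately show ?thesis by (simp add: cl_characteristics_def)
  qed
  moreover have "f + g \<in> cl_characteristics p" if "f \<in> cl_characteristics p" "g \<in> cl_characteristics p" for f g
    using that total_divergence_add[of p "\<lambda>x. f x * x (W 1 1)" "\<lambda>x. g x * x (W 1 1)"] diff_functions_add
    by (auto simp: cl_characteristics_def distrib_right plus_fun_apply)
  moreover have "(\<lambda>x. r * f x) \<in> cl_characteristics p" if "f \<in> cl_characteristics p" for f r
    using that total_divergence_scale[of p "\<lambda>x. f x * x (W 1 1)" _ r] diff_functions_scale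
    by (auto simp: cl_characteristics_def mult.assoc)
  ultimately show ?thesis by (simp add: jetfun.subspace_def)
qed

section \<open>The distinguished symmetries\<close>

lemma special_functions_near:
  assumes "\<mu> \<in> special_functions p"
  shows "\<exists>n. near_box p (\<lambda>B. \<forall>m\<ge>n. jet_box.special_box B m (jet_box.cut B \<mu>))"
proof -
  obtain r\<^sub>1 r\<^sub>2 F G where
    F: "F \<in> smooth_functions_of p (insert Eta {W 0 l |l. 1 \<le> l \<and> l \<le> r\<^sub>1})" and
    G: "G \<in> smooth_functions_of p (insert Xi {W k 0 |k. 1 \<le> k \<and> k \<le> r\<^sub>2})" and
    \<mu>: "\<forall>\<^sub>F x in nhds p. \<mu> x = special_form r\<^sub>1 r\<^sub>2 F G x"
    using assms unfolding special_functions_def by blast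
  have fin: "finite (insert Eta {W 0 l |l. 1 \<le> l \<and> l \<le> r\<^sub>1})" "finite (insert Xi {W k 0 |k. 1 \<le> k \<and> k \<le> r\<^sub>2})"
    by simp_all
  have "near_box p (\<lambda>B. \<forall>m\<ge>max r\<^sub>1 r\<^sub>2. jet_box.special_box B m (jet_box.cut B \<mu>))"
  proof (rule near_box_mono[OF near_box_conj[OF smooth_functions_near[OF F fin(1)]
          near_box_conj[OF smooth_functions_near[OF G fin(2)] near_box_eventually[OF \<mu>]]]])
    fix B assume "jet_box p B"
    then interpret jet_box p B .
    assume "(cut F \<in> box_functions \<and>
          (\<forall>c. c \<notin> insert Eta {W 0 l |l. 1 \<le> l \<and> l \<le> r\<^sub>1} \<longrightarrow> part c (cut F) = 0)) \<and>
        (cut G \<in> box_functions \<and>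
          (\<forall>c. c \<notin> insert Xi {W k 0 |k. 1 \<le> k \<and> k \<le> r\<^sub>2} \<longrightarrow> part c (cut G) = 0)) \<and>
        (\<forall>x\<in>B. \<mu> x = special_form r\<^sub>1 r\<^sub>2 F G x)"
    then have F': "cut F \<in> box_functions" "\<And>c. c \<notin> reduced_coords False r\<^sub>1 \<Longrightarrow> part c (cut F) = 0"
      and G': "cut G \<in> box_functions" "\<And>c. c \<notin> reduced_coords True r\<^sub>2 \<Longrightarrow> part c (cut G) = 0"
      and \<mu>': "\<And>x. x \<in> B \<Longrightarrow> \<mu> x = special_form r\<^sub>1 r\<^sub>2 F G x"
      unfolding reduced_coords_eq by blast+
    show "\<forall>m\<ge>max r\<^sub>1 r\<^sub>2. special_box m (cut \<mu>)"
    proof (intro allI impI)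
      fix m assume m: "max r\<^sub>1 r\<^sub>2 \<le> m"
      define H where "H = (\<lambda>b. if b then cut G else cut F)"
      have sub: "reduced_coords False r\<^sub>1 \<subseteq> reduced_coords False m" "reduced_coords True r\<^sub>2 \<subseteq> reduced_coords True m"
        using m by (auto simp: reduced_coords_def)
      have top: "axis_var False k \<notin> reduced_coords False r\<^sub>1" if "r\<^sub>1 < k" for k
        using that by (auto simp: reduced_coords_def)
      have top': "axis_var True k \<notin> reduced_coords True r\<^sub>2" if "r\<^sub>2 < k" for k
        using that by (auto simp: reduced_coords_def)
      have "euler False S m (cut F) = euler False S r\<^sub>1 (cut F)" "euler True S m (cut G) = euler True S r\<^sub>2 (cut G)" for S
        using m F' G' top top' by (auto intro!: euler_extend)
      then have "cut \<mu> = euler True (line True - {W 0 0}) m (H True) + euler False (line False - {W 0 0}) m (H False)"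
        using F' G'
        by (auto simp: H_def fun_eq_iff cut_def[of \<mu>] \<mu>' special_form_at plus_fun_apply box_functions_outside)
      moreover have "H b \<in> box_functions" "c \<notin> reduced_coords b m \<Longrightarrow> part c (H b) = 0" for b c
        using F' G' sub by (cases b; auto simp: H_def)+
      ultimately show "special_box m (cut \<mu>)" unfolding special_box_def by blast
    qed
  qed
  then show ?thesis by blast
qed

lemma special_functions_add:
  assumes "\<mu> \<in> special_functions p" "\<nu> \<in> special_functions p"
  shows "\<mu> + \<nu> \<in> special_functions p"
proof -
  obtain m n where
    m: "near_box p (\<lambda>B. \<forall>k\<ge>m. jet_box.special_box B k (jet_box.cut B \<mu>))" and
    n: "near_box p (\<lambda>B. \<forall>k\<ge>n. jet_box.special_box B k (jet_box.cut B \<nu>))"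
    using assms[THEN special_functions_near] by blast
  obtain B where B: "jet_box p B"
    and special: "(\<forall>k\<ge>m. jet_box.special_box B k (jet_box.cut B \<mu>)) \<and>
      (\<forall>k\<ge>n. jet_box.special_box B k (jet_box.cut B \<nu>))"
    by (rule near_boxE[OF near_box_conj[OF m n]])
  interpret jet_box p B by fact
  have "special_box (max m n) (cut \<mu>)" "special_box (max m n) (cut \<nu>)" using special by simp_all
  from special_box_add[OF this] show ?thesis by (intro special_functionsI) (simp add: cut_add)
qed

lemma special_functions_scale:
  assumes "\<mu> \<in> special_functions p"
  shows "(\<lambda>x. r * \<mu> x) \<in> special_functions p"
proof -
  obtain n where n: "near_box p (\<lambda>B. \<forall>k\<ge>n. jet_box.special_box B k (jet_box.cut B \<mu>))"
    using special_functions_near[OF assms] by blast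
  obtain B where "jet_box p B" and all: "\<forall>k\<ge>n. jet_box.special_box B k (jet_box.cut B \<mu>)"
    by (rule near_boxE[OF n])
  interpret jet_box p B by fact
  have special: "special_box n (cut \<mu>)" using all by simp
  show ?thesis using special_box_scale[OF special] by (intro special_functionsI) (simp add: cut_scale)
qed

lemma subspace_special_functions: "jetfun.subspace (special_functions p)"
proof -
  obtain B where B: "jet_box p B" using box_in_open[of UNIV p] by auto
  interpret jet_box p B by fact
  have "special_box 0 0"
    unfolding special_box_def by (intro exI[of _ "\<lambda>b. 0"]) (simp add: euler_def)
  then have "0 \<in> special_functions p" by (intro special_functionsI) simp
  then show ?thesis
    using special_functions_add special_functions_scale by (simp add: jetfun.subspace_def)
qed

lemma special_functions_subset_cl_characteristics: "special_functions p \<subseteq> cl_characteristics p"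
proof
  fix \<mu> assume "\<mu> \<in> special_functions p"
  then obtain n where n: "near_box p (\<lambda>B. \<forall>k\<ge>n. jet_box.special_box B k (jet_box.cut B \<mu>))"
    using special_functions_near by blast
  obtain B where "jet_box p B" and all: "\<forall>k\<ge>n. jet_box.special_box B k (jet_box.cut B \<mu>)"
    by (rule near_boxE[OF n])
  interpret jet_box p B by fact
  have special: "special_box n (cut \<mu>)" using all by simp
  obtain P Q where PQ: "P \<in> box_functions" "Q \<in> box_functions"
      "cut \<mu> * jet_var (W 1 1) = D True UNIV P + D False UNIV Q"
    using special_box_divergence[OF special] by blast
  have "\<mu> x * x (W 1 1) = D True UNIV P x + D False UNIV Q x" if "x \<in> B" for x
    using fun_cong[OF PQ(3), of x] that by (simp add: times_fun_apply plus_fun_apply jet_var_def)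
  then have "total_divergence p (\<lambda>x. \<mu> x * x (W 1 1))" using PQ by (intro total_divergenceI)
  moreover have "\<mu> \<in> diff_functions p" using special_box_closed[OF special] by (rule diff_functionsI)
  ultimately show "\<mu> \<in> cl_characteristics p" by (simp add: cl_characteristics_def)
qed

text \<open>
  Near \<open>p\<close> the function does not change when the variables \<open>w\<^sub>k\<^sub>l\<close> with \<open>k, l \<ge> 1\<close> are set to \<open>0\<close>, which moves
  any point of a box into the solution set.
\<close>

lemma special_functions_vanishing:
  assumes p: "p \<in> solution_set"
    and \<mu>: "\<mu> \<in> special_functions p" "\<mu> \<in> vanishing_on_solutions p"
  shows "\<mu> \<in> vanishing_germ p"
proof -
  obtain n where n: "near_box p (\<lambda>B. \<forall>k\<ge>n. jet_box.special_box B k (jet_box.cut B \<mu>))"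
    using special_functions_near[OF \<mu>(1)] by blast
  have zero: "\<forall>\<^sub>F x in nhds p. x \<in> solution_set \<longrightarrow> \<mu> x = 0"
    using \<mu>(2) by (simp add: vanishing_on_solutions_def)
  obtain B where "jet_box p B"
    and B: "(\<forall>k\<ge>n. jet_box.special_box B k (jet_box.cut B \<mu>)) \<and> (\<forall>x\<in>B. x \<in> solution_set \<longrightarrow> \<mu> x = 0)"
    by (rule near_boxE[OF near_box_conj[OF n near_box_eventually[OF zero]]])
  interpret jet_box p B by fact
  have special: "special_box n (cut \<mu>)" using B by simp
  have "\<mu> x = 0" if "x \<in> B" for x
  proof -
    have "freeze mixed (cut \<mu>) = cut \<mu>"
      using special_box_part_mixed[OF special] special_box_closed[OF special] by (intro freeze_id)
    then have "\<mu> x = \<mu> (frozen mixed x)"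
      using that frozen_in_B[OF that, of mixed] by (metis cut_in freeze_in)
    also have "frozen mixed x \<in> solution_set"
      using p by (auto simp: solution_set_def frozen_def mixed_def)
    then have "\<mu> (frozen mixed x) = 0" using B frozen_in_B[OF that] by blast
    finally show ?thesis .
  qed
  moreover have "\<forall>\<^sub>F x in nhds p. x \<in> B" using open_B p_in_B by (auto simp: eventually_nhds)
  ultimately show ?thesis unfolding vanishing_germ_def by (auto elim: eventually_mono)
qed

lemma cl_characteristics_eq_special_on_solutions:
  assumes p: "p \<in> solution_set" and \<mu>: "\<mu> \<in> cl_characteristics p"
  shows "\<exists>\<nu>\<in>special_functions p. \<mu> - \<nu> \<in> vanishing_on_solutions p"
proof -
  have "\<mu> \<in> diff_functions p" "total_divergence p (\<lambda>x. \<mu> x * x (W 1 1))"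
    using \<mu> by (auto simp: cl_characteristics_def)
  then obtain B where "jet_box p B" and B: "jet_box.cut B \<mu> \<in> jet_box.box_functions B \<and>
    (\<exists>P\<in>jet_box.box_functions B. \<exists>Q\<in>jet_box.box_functions B.
      \<forall>x\<in>B. \<mu> x * x (W 1 1) = jet_box.D B True UNIV P x + jet_box.D B False UNIV Q x)"
    by (elim near_boxE[OF near_box_conj[OF diff_functions_near total_divergence_near]])
  interpret jet_box p B by fact
  have M: "cut \<mu> \<in> box_functions" using B by simp
  obtain P Q where PQ: "P \<in> box_functions" "Q \<in> box_functions"
    "\<And>x. x \<in> B \<Longrightarrow> \<mu> x * x (W 1 1) = D True UNIV P x + D False UNIV Q x"
    using B by blast
  have "cut \<mu> * jet_var (W 1 1) = D True UNIV P + D False UNIV Q"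
  proof
    fix x show "(cut \<mu> * jet_var (W 1 1)) x = (D True UNIV P + D False UNIV Q) x"
      using PQ by (cases "x \<in> B") (simp_all add: times_fun_apply plus_fun_apply jet_var_def box_functions_outside)
  qed
  from characteristic_eq_special_on_solutions[OF p M PQ(1,2) this]
  obtain n where n: "special_box n (freeze mixed (cut \<mu>))" by blast
  let ?\<nu> = "freeze mixed (cut \<mu>)"
  have "?\<nu> \<in> special_functions p" using n M by (intro special_functionsI) simp
  moreover have "\<mu> x - ?\<nu> x = 0" if "x \<in> B" "x \<in> solution_set" for x
  proof -
    have "frozen mixed x = x"
      using p that(2) by (auto simp: frozen_def mixed_def solution_set_def fun_eq_iff)
    then show ?thesis using that by (simp add: freeze_in)
  qed
  moreover have "\<forall>\<^sub>F x in nhds p. x \<in> B" using open_B p_in_B by (auto simp: eventually_nhds)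
  ultimately show ?thesis
    unfolding vanishing_on_solutions_def
    by (intro bexI[of _ ?\<nu>]) (auto elim!: eventually_mono simp: minus_apply)
qed

section \<open>Quotient spaces and the main result\<close>

lemma class_add_eq:
  assumes V: "jetfun.subspace V" and N: "jetfun.subspace N" and "f \<in> V" "g \<in> V"
  shows "class_add (coset_rel V N) (coset_rel V N `` {f}) (coset_rel V N `` {g}) = coset_rel V N `` {f + g}"
proof -
  let ?r = "coset_rel V N"
  note eq = equiv_coset_rel[OF N, of V]
  have "?r `` {f' + g'} = ?r `` {f + g}" if "(f, f') \<in> ?r" "(g, g') \<in> ?r" for f' g'
  proof -
    have "(f - f') + (g - g') \<in> N"
      using that jetfun.subspace_add[OF N] unfolding coset_rel_def by blast
    moreover have "(f - f') + (g - g') = (f + g) - (f' + g')" by simp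
    ultimately have "(f + g, f' + g') \<in> ?r"
      using that jetfun.subspace_add[OF V] by (simp add: coset_rel_def)
    then show ?thesis using equiv_class_eq[OF eq] by blast
  qed
  moreover have "(f, f) \<in> ?r" "(g, g) \<in> ?r"
    using assms jetfun.subspace_0[OF N] by (auto simp: coset_rel_def)
  ultimately show ?thesis unfolding class_add_def by blast
qed

lemma class_scale_eq:
  assumes V: "jetfun.subspace V" and N: "jetfun.subspace N" and "f \<in> V"
  shows "class_scale (coset_rel V N) c (coset_rel V N `` {f}) = coset_rel V N `` {\<lambda>x. c * f x}"
proof -
  let ?r = "coset_rel V N"
  note eq = equiv_coset_rel[OF N, of V]
  have "?r `` {\<lambda>x. c * f' x} = ?r `` {\<lambda>x. c * f x}" if "(f, f') \<in> ?r" for f'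
  proof -
    have "(\<lambda>x. c * (f - f') x) \<in> N"
      using that jetfun.subspace_scale[OF N] unfolding coset_rel_def by blast
    moreover have "(\<lambda>x. c * (f - f') x) = (\<lambda>x. c * f x) - (\<lambda>x. c * f' x)"
      by (auto simp: right_diff_distrib)
    ultimately have "((\<lambda>x. c * f x), (\<lambda>x. c * f' x)) \<in> ?r"
      using that jetfun.subspace_scale[OF V] by (simp add: coset_rel_def)
    then show ?thesis using equiv_class_eq[OF eq] by blast
  qed
  moreover have "(f, f) \<in> ?r"
    using assms jetfun.subspace_0[OF N] by (auto simp: coset_rel_def)
  ultimately show ?thesis unfolding class_scale_def by blast
qed

text \<open>
  The isomorphism sends a class to the union of the larger classes of its members.
\<close>

lemma quotient_iso_by_representatives:
  assumes V: "jetfun.subspace V" "jetfun.subspace V'" "V \<subseteq> V'"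
    and N: "jetfun.subspace N" "jetfun.subspace N'" "N \<subseteq> N'"
    and inj: "\<And>f. f \<in> V \<Longrightarrow> f \<in> N' \<Longrightarrow> f \<in> N"
    and surj: "\<And>g. g \<in> V' \<Longrightarrow> \<exists>f\<in>V. g - f \<in> N'"
  shows "\<exists>\<Phi>. quotient_iso V N V' N' \<Phi> \<and>
    (\<forall>f\<in>V. \<Phi> (coset_rel V N `` {f}) = coset_rel V' N' `` {f})"
proof -
  let ?r = "coset_rel V N" and ?r' = "coset_rel V' N'"
  note eq = equiv_coset_rel[OF N(1), of V] and eq' = equiv_coset_rel[OF N(2), of V']
  define \<Phi> where "\<Phi> = (\<lambda>Y. ?r' `` Y)"
  have \<Phi>: "\<Phi> (?r `` {f}) = ?r' `` {f}" if "f \<in> V" for f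
  proof -
    have "?r' `` {g} = ?r' `` {f}" if "(f, g) \<in> ?r" for g
    proof -
      have "(f, g) \<in> ?r'" using that V(3) N(3) by (auto simp: coset_rel_def)
      then show ?thesis using equiv_class_eq[OF eq'] by blast
    qed
    moreover have "(f, f) \<in> ?r" using that jetfun.subspace_0[OF N(1)] by (simp add: coset_rel_def)
    ultimately show ?thesis unfolding \<Phi>_def by blast
  qed
  have "bij_betw \<Phi> (V // ?r) (V' // ?r')"
    unfolding bij_betw_def
  proof
    show "inj_on \<Phi> (V // ?r)"
    proof (rule inj_onI)
      fix Y Z assume "Y \<in> V // ?r" "Z \<in> V // ?r" and YZ: "\<Phi> Y = \<Phi> Z"
      then obtain f g where fg: "f \<in> V" "g \<in> V" "Y = ?r `` {f}" "Z = ?r `` {g}"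
        by (auto elim!: quotientE)
      then have "?r' `` {f} = ?r' `` {g}" using YZ \<Phi> by simp
      then have "(f, g) \<in> ?r'" using eq_equiv_class[OF _ eq'] fg(2) V(3) by blast
      then have "(f, g) \<in> ?r"
        using fg inj[of "f - g"] jetfun.subspace_diff[OF V(1)] by (simp add: coset_rel_def)
      then show "Y = Z" using equiv_class_eq[OF eq] fg by blast
    qed
    show "\<Phi> ` (V // ?r) = V' // ?r'"
    proof
      show "\<Phi> ` (V // ?r) \<subseteq> V' // ?r'"
        using V(3) by (auto elim!: quotientE simp: \<Phi> intro!: quotientI)
      show "V' // ?r' \<subseteq> \<Phi> ` (V // ?r)"
      proof
        fix Y assume "Y \<in> V' // ?r'"
        then obtain g where g: "g \<in> V'" "Y = ?r' `` {g}" by (auto elim!: quotientE)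
        then obtain f where f: "f \<in> V" "g - f \<in> N'" using surj by blast
        then have "(g, f) \<in> ?r'" using g V(3) by (auto simp: coset_rel_def)
        then have "Y = \<Phi> (?r `` {f})" using equiv_class_eq[OF eq'] g f \<Phi> by simp
        then show "Y \<in> \<Phi> ` (V // ?r)" using f by (auto intro: quotientI)
      qed
    qed
  qed
  moreover have "\<Phi> (class_add ?r Y Z) = class_add ?r' (\<Phi> Y) (\<Phi> Z)" if YZ: "Y \<in> V // ?r" "Z \<in> V // ?r" for Y Z
  proof -
    obtain f g where fg: "f \<in> V" "g \<in> V" "Y = ?r `` {f}" "Z = ?r `` {g}"
      using YZ by (auto elim!: quotientE)
    moreover from fg have "f \<in> V'" "g \<in> V'" "f + g \<in> V" using V jetfun.subspace_add by blast+
    ultimately show ?thesis using V N by (simp add: class_add_eq \<Phi>)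
  qed
  moreover have "\<Phi> (class_scale ?r c Y) = class_scale ?r' c (\<Phi> Y)" if Y: "Y \<in> V // ?r" for c Y
  proof -
    obtain f where f: "f \<in> V" "Y = ?r `` {f}" using Y by (auto elim!: quotientE)
    moreover from f have "f \<in> V'" "(\<lambda>x. c * f x) \<in> V" using V jetfun.subspace_scale by blast+
    ultimately show ?thesis using V N by (simp add: class_scale_eq \<Phi>)
  qed
  ultimately show ?thesis using \<Phi> unfolding quotient_iso_def Let_def by blast
qed

theorem lemma2:
  fixes p :: jet
  assumes "p \<in> solution_set"
  shows "variational_symmetries p = cl_characteristics p
    \<and> jetfun.subspace (variational_symmetries p)
    \<and> jetfun.subspace (special_functions p)
    \<and> special_functions p \<subseteq> variational_symmetries p
    \<and> (\<exists>\<Phi>.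
          quotient_iso
            (special_functions p) (vanishing_germ p)
            (variational_symmetries p) (vanishing_on_solutions p) \<Phi>
        \<and> (\<forall>\<mu>\<in>special_functions p.
            \<Phi> (coset_rel (special_functions p) (vanishing_germ p) `` {\<mu>}) =
              coset_rel (variational_symmetries p) (vanishing_on_solutions p) `` {\<mu>}))"
proof -
  have "vanishing_germ p \<subseteq> vanishing_on_solutions p"
    by (auto simp: vanishing_germ_def vanishing_on_solutions_def elim: eventually_mono)
  then have "\<exists>\<Phi>. quotient_iso (special_functions p) (vanishing_germ p)
        (cl_characteristics p) (vanishing_on_solutions p) \<Phi>
      \<and> (\<forall>\<mu>\<in>special_functions p.
          \<Phi> (coset_rel (special_functions p) (vanishing_germ p) `` {\<mu>}) =
            coset_rel (cl_characteristics p) (vanishing_on_solutions p) `` {\<mu>})"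
    using assms
    by (intro quotient_iso_by_representatives subspace_special_functions subspace_cl_characteristics
        special_functions_subset_cl_characteristics subspace_vanishing_germ
        subspace_vanishing_on_solutions special_functions_vanishing
        cl_characteristics_eq_special_on_solutions)
  then show ?thesis
    unfolding variational_symmetries_eq_cl_characteristics
    using subspace_cl_characteristics subspace_special_functions
      special_functions_subset_cl_characteristics by blast
qed

end
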